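(* For $j\in\{\tfrac12,1,\tfrac32,\dots\}$ let $\mathcal{H}_{\mathrm{inv}}=\mathrm{Inv}_{SU(2)}(V_j^{\otimes 4})$, let $|I\rangle$ be a Haar-random unit vector in $\mathcal{H}_{\mathrm{inv}}$, let $\rho_{34}=\mathrm{Tr}_{12}|I\rangle\langle I|$, and let $S_2=-\ln\frac{\mathrm{Tr}\,\rho_{34}^2}{(\mathrm{Tr}\,\rho_{34})^2}$ be its second Rényi entropy. Put $\Lambda=\sum_{I=0}^{2j}\frac{1}{2I+1}$ and $$\overline{S_2}=\ln\!\left[(2j+1)^2+(2j+1)\right]-\ln(2\Lambda).$$ Then for every sufficiently small $\delta>0$ (i.e. there is an absolute constant $\delta_0>0$ such that this holds for all $0<\delta\le\delta_0$) and all sufficiently large $j$ (depending on $\delta$), $$\mathrm{Prob}\big(|S_2-\overline{S_2}|\le\delta\big)\ \ge\ 1-\frac{3\pi^2}{\delta^2\Lambda^2},$$ where the right-hand side tends to $1$ as $j\to\infty$.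
   Context: $V_j$ is the irreducible spin-$j$ representation of $SU(2)$ of dimension $2j+1$, and $\mathrm{Inv}_{SU(2)}(V_j^{\otimes 4})$ is the subspace of vectors fixed by the diagonal $SU(2)$ action (of dimension $2j+1$). A Haar-random unit vector in $\mathcal{H}_{\mathrm{inv}}$ is $U|0\rangle$ with $|0\rangle$ a fixed unit vector and $U$ Haar-distributed in the unitary group of $\mathcal{H}_{\mathrm{inv}}$. $\mathrm{Tr}_{12}$ is the partial trace over the first two tensor factors. $I$ in the definition of $\Lambda$ runs over the integers $0,\dots,2j$. The number $\overline{S_2}$ equals $-\ln\big(\overline{\mathrm{Tr}\,\rho_{34}^2}\,/\,\overline{(\mathrm{Tr}\,\rho_{34})^2}\big)$, where overline denotes the Haar average. *)

theory Defs
  imports "HOL-Analysis.Analysis" "HOL-Computational_Algebra.Polynomial"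
begin

text \<open>
  Throughout, the natural number \<open>n\<close> is twice the spin, \<open>n = 2j\<close>, so the spin-\<open>j\<close> space has
  dimension \<open>n + 1\<close>; its basis is indexed by \<open>0, \<dots>, n\<close>.
\<close>

definition SU2 :: "(complex^2^2) set" where
  "SU2 = {g. g ** (\<chi> i k. cnj (g $ k $ i)) = mat 1 \<and> det g = 1}"

text \<open>
  The spin-\<open>j\<close> representation on homogeneous polynomials of degree \<open>n\<close> in \<open>(x, y)\<close>, with \<open>g\<close>
  acting by \<open>(g f)(x, y) = f((x, y) g)\<close>. The matrix entries are taken in the basis
  \<open>e k = x^k y^(n-k) / sqrt (k! (n-k)!)\<close>, which is orthonormal for the invariant inner product;
  the coefficients of \<open>x^m y^(n-m)\<close> are read off after setting \<open>y = 1\<close>.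
  For \<open>n = 1\<close> this is the defining representation.
\<close>

definition spin_rep :: "nat \<Rightarrow> complex^2^2 \<Rightarrow> nat \<Rightarrow> nat \<Rightarrow> complex" where
  "spin_rep n g m k =
     complex_of_real (sqrt (fact m * fact (n - m) / (fact k * fact (n - k)))) *
     coeff ([:g $ 2 $ 1, g $ 1 $ 1:] ^ k * [:g $ 2 $ 2, g $ 1 $ 2:] ^ (n - k)) m"

type_synonym tensor4 = "nat \<times> nat \<times> nat \<times> nat \<Rightarrow> complex"

definition idx4 :: "nat \<Rightarrow> (nat \<times> nat \<times> nat \<times> nat) set" where
  "idx4 n = {..n} \<times> {..n} \<times> {..n} \<times> {..n}"

definition tensor_space4 :: "nat \<Rightarrow> tensor4 set" where
  "tensor_space4 n = {\<psi>. \<forall>i. i \<notin> idx4 n \<longrightarrow> \<psi> i = 0}"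

definition cinner4 :: "nat \<Rightarrow> tensor4 \<Rightarrow> tensor4 \<Rightarrow> complex" where
  "cinner4 n \<phi> \<psi> = (\<Sum>i\<in>idx4 n. cnj (\<phi> i) * \<psi> i)"

definition diag_action :: "nat \<Rightarrow> complex^2^2 \<Rightarrow> tensor4 \<Rightarrow> tensor4" where
  "diag_action n g \<psi> = (\<lambda>(a, b, c, d).
     \<Sum>(a', b', c', d')\<in>idx4 n.
       spin_rep n g a a' * spin_rep n g b b' * spin_rep n g c c' * spin_rep n g d d' *
       \<psi> (a', b', c', d'))"

definition H_inv :: "nat \<Rightarrow> tensor4 set" where
  "H_inv n = {\<psi> \<in> tensor_space4 n.
     \<forall>g\<in>SU2. \<forall>i\<in>idx4 n. diag_action n g \<psi> i = \<psi> i}"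

text \<open>
  Operators on \<open>H_inv n\<close> are functions that are extensional on \<open>H_inv n\<close> (\<open>undefined\<close> elsewhere);
  the group operation is \<open>compose (H_inv n)\<close>.
\<close>

definition unitary_group :: "nat \<Rightarrow> (tensor4 \<Rightarrow> tensor4) set" where
  "unitary_group n = {U \<in> extensional (H_inv n).
     bij_betw U (H_inv n) (H_inv n) \<and>
     (\<forall>\<phi>\<in>H_inv n. \<forall>\<psi>\<in>H_inv n. \<forall>a b.
        U (\<lambda>i. a * \<phi> i + b * \<psi> i) = (\<lambda>i. a * U \<phi> i + b * U \<psi> i)) \<and>
     (\<forall>\<phi>\<in>H_inv n. \<forall>\<psi>\<in>H_inv n. cinner4 n (U \<phi>) (U \<psi>) = cinner4 n \<phi> \<psi>)}"

text \<open>
  The topology on the function type is that of pointwise convergence. On the unitary group of the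
  finite-dimensional space \<open>H_inv n\<close> it induces the usual topology, so \<open>restrict_space borel\<close>
  carries the Borel sigma-algebra of that compact group. A left-invariant probability measure on a
  compact group is its unique (two-sided) Haar measure.
\<close>

definition haar_unitary :: "nat \<Rightarrow> (tensor4 \<Rightarrow> tensor4) measure \<Rightarrow> bool" where
  "haar_unitary n \<mu> \<longleftrightarrow>
     sets \<mu> = sets (restrict_space borel (unitary_group n)) \<and>
     emeasure \<mu> (space \<mu>) = 1 \<and>
     (\<forall>U\<in>unitary_group n. distr \<mu> \<mu> (\<lambda>V. compose (H_inv n) U V) = \<mu>)"

text \<open>Operators on tensor products are given by their kernels (matrix entries).\<close>

definition ketbra :: "tensor4 \<Rightarrow>
    nat \<times> nat \<times> nat \<times> nat \<Rightarrow> nat \<times> nat \<times> nat \<times> nat \<Rightarrow> complex" where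
  "ketbra \<psi> i k = \<psi> i * cnj (\<psi> k)"

definition partial_trace12 :: "nat \<Rightarrow>
    (nat \<times> nat \<times> nat \<times> nat \<Rightarrow> nat \<times> nat \<times> nat \<times> nat \<Rightarrow> complex) \<Rightarrow>
    nat \<times> nat \<Rightarrow> nat \<times> nat \<Rightarrow> complex" where
  "partial_trace12 n R =
     (\<lambda>(c, d) (c', d'). \<Sum>a\<le>n. \<Sum>b\<le>n. R (a, b, c, d) (a, b, c', d'))"

definition trace2 :: "nat \<Rightarrow> (nat \<times> nat \<Rightarrow> nat \<times> nat \<Rightarrow> complex) \<Rightarrow> complex" where
  "trace2 n A = (\<Sum>i\<in>{..n} \<times> {..n}. A i i)"

definition mult2 :: "nat \<Rightarrow> (nat \<times> nat \<Rightarrow> nat \<times> nat \<Rightarrow> complex) \<Rightarrow>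
    (nat \<times> nat \<Rightarrow> nat \<times> nat \<Rightarrow> complex) \<Rightarrow> nat \<times> nat \<Rightarrow> nat \<times> nat \<Rightarrow> complex" where
  "mult2 n A B i k = (\<Sum>l\<in>{..n} \<times> {..n}. A i l * B l k)"

definition rho34 :: "nat \<Rightarrow> tensor4 \<Rightarrow> nat \<times> nat \<Rightarrow> nat \<times> nat \<Rightarrow> complex" where
  "rho34 n \<psi> = partial_trace12 n (ketbra \<psi>)"

text \<open>Both traces are nonnegative reals, so taking \<open>Re\<close> loses nothing.\<close>

definition S2 :: "nat \<Rightarrow> tensor4 \<Rightarrow> real" where
  "S2 n \<psi> = - ln (Re (trace2 n (mult2 n (rho34 n \<psi>) (rho34 n \<psi>))) /
                  (Re (trace2 n (rho34 n \<psi>)))\<^sup>2)"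

definition Lam :: "nat \<Rightarrow> real" where
  "Lam n = (\<Sum>I=0..n. 1 / (2 * real I + 1))"

definition S2_bar :: "nat \<Rightarrow> real" where
  "S2_bar n = ln ((real n + 1)\<^sup>2 + (real n + 1)) - ln (2 * Lam n)"

end

theory Submission imports Defs "HOL-Probability.Probability_Measure" begin

text \<open>
  Writing an invariant tensor as an operator between the first and the last pair of factors, Schur's
  lemma and the multiplicity-free decomposition of \<open>V\<^sub>j \<otimes> V\<^sub>j\<close> into the spins
  \<open>J = 0, \<dots>, n\<close> give an orthonormal basis \<open>e\<^sub>J\<close> of \<open>H_inv n\<close> in which
  \<open>Tr \<rho>\<^sup>2 = (\<Sum>J. \<bar>\<alpha>\<^sub>J\<bar>^4 / (2 J + 1))\<close>. Unitary invariance fixes the fourth moments of the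
  weights \<open>\<bar>\<alpha>\<^sub>J\<bar>\<^sup>2\<close>: the relative variance of \<open>Tr \<rho>\<^sup>2\<close> is at most
  \<open>5 (\<Sum>J. 1 / (2 J + 1)\<^sup>2) / \<Lambda>\<^sup>2\<close>, and Chebyshev's inequality gives the bound, for every
  \<open>n\<close> and every \<open>\<delta> \<le> 1\<close>.
\<close>

text \<open>Schur's lemma is not invoked as such. Invariance under the group is first traded for
  linear conditions: total weight \<open>2 * n\<close> and annihilation by the raising and lowering
  operators. In that form both the absence of couplings between different spins and the uniqueness
  of the coupling between equal spins become two-term recursions with explicit square roots. About
  Haar measure only left invariance is used: phases of one coordinate and rotations in coordinate
  planes, together with the unit norm, fix every moment that occurs. For a unit vector the trace of
  \<open>rho34\<close> is 1, so \<open>S2\<close> is minus the logarithm of the purity, and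
  \<open>S2_bar\<close> is minus the logarithm of its mean
  \<open>2 * Lam n / ((n + 1) * (n + 2))\<close>. Concentration rests on the contrast between
  \<open>Lam n\<close>, which diverges like a harmonic sum, and the bounded sum of the squared
  weights. The constant: a relative error \<open>\<delta> / 2\<close> in Chebyshev's inequality
  turns 5 into 20, the squared weights sum to at most 5/4, and 25 is below 27, which is at most
  \<open>3 * pi^2\<close>.\<close>

section \<open>The Clebsch-Gordan basis\<close>

text \<open>The matrix entry of the raising operator from the basis vector \<open>e k\<close> to \<open>e (k + 1)\<close>;
  truncated subtraction makes it vanish for \<open>k \<ge> n\<close>.\<close>

definition ladder :: "nat \<Rightarrow> nat \<Rightarrow> complex" where
  "ladder n k = complex_of_real (sqrt (real ((k + 1) * (n - k))))"

lemma ladder_eq_0 [simp]: "n \<le> k \<Longrightarrow> ladder n k = 0"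
  by (simp add: ladder_def)

lemma ladder_nonzero: "k < n \<Longrightarrow> ladder n k \<noteq> 0"
  unfolding ladder_def of_real_eq_0_iff real_sqrt_eq_zero_cancel_iff of_nat_eq_0_iff by simp

lemma cnj_ladder [simp]: "cnj (ladder n k) = ladder n k"
  by (simp add: ladder_def)

lemma ladder_square: "ladder n k * ladder n k = of_nat ((k + 1) * (n - k))"
proof -
  have "ladder n k * ladder n k = complex_of_real (sqrt (real ((k + 1) * (n - k))) * sqrt (real ((k + 1) * (n - k))))"
    unfolding ladder_def of_real_mult ..
  also have "\<dots> = complex_of_real (real ((k + 1) * (n - k)))"
    by (subst real_sqrt_mult_self) simp
  finally show ?thesis by (simp only: of_real_of_nat_eq)
qed

lemma ladder_reflect: "k < n \<Longrightarrow> ladder n (n - Suc k) = ladder n k"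
  by (simp add: ladder_def Suc_diff_Suc mult.commute)

text \<open>Operators act on coefficient functions: the new coefficient at \<open>a\<close> comes
  from the old one at \<open>Suc a\<close>, hence the seemingly reversed shift.\<close>

definition lower1 :: "nat \<Rightarrow> (nat \<Rightarrow> complex) \<Rightarrow> nat \<Rightarrow> complex" where
  "lower1 n f a = ladder n a * f (Suc a)"

definition raise1 :: "nat \<Rightarrow> (nat \<Rightarrow> complex) \<Rightarrow> nat \<Rightarrow> complex" where
  "raise1 n f a = (case a of 0 \<Rightarrow> 0 | Suc k \<Rightarrow> ladder n k * f k)"

definition lower2 :: "nat \<Rightarrow> (nat \<Rightarrow> nat \<Rightarrow> complex) \<Rightarrow> nat \<Rightarrow> nat \<Rightarrow> complex" where
  "lower2 n f a b = lower1 n (\<lambda>x. f x b) a + lower1 n (f a) b"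

definition raise2 :: "nat \<Rightarrow> (nat \<Rightarrow> nat \<Rightarrow> complex) \<Rightarrow> nat \<Rightarrow> nat \<Rightarrow> complex" where
  "raise2 n f a b = raise1 n (\<lambda>x. f x b) a + raise1 n (f a) b"

text \<open>Bilinear, without conjugation, so that raising and lowering are transposes of each
  other. The Clebsch-Gordan vectors are real, so pairing with them agrees with the Hermitian
  product.\<close>

definition pair2 :: "nat \<Rightarrow> (nat \<Rightarrow> nat \<Rightarrow> complex) \<Rightarrow> (nat \<Rightarrow> nat \<Rightarrow> complex) \<Rightarrow> complex" where
  "pair2 n f g = (\<Sum>a\<le>n. \<Sum>b\<le>n. f a b * g a b)"

lemma raise1_adjoint:
  "(\<Sum>a\<le>n. raise1 n f a * g a) = (\<Sum>a\<le>n. f a * lower1 n g a)"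
proof (cases n)
  case 0
  then show ?thesis by (simp add: raise1_def lower1_def)
next
  case (Suc m)
  have "(\<Sum>a\<le>n. raise1 n f a * g a) = (\<Sum>a\<le>m. ladder n a * f a * g (Suc a))"
    unfolding Suc by (subst sum.atMost_Suc_shift) (simp add: raise1_def)
  also have "\<dots> = (\<Sum>a\<le>n. f a * lower1 n g a)"
    by (simp add: Suc lower1_def mult_ac)
  finally show ?thesis .
qed

lemma pair2_commute: "pair2 n f g = pair2 n g f"
  by (simp add: pair2_def mult.commute)

lemma pair2_raise: "pair2 n (raise2 n f) g = pair2 n f (lower2 n g)"
proof -
  have 1: "(\<Sum>a\<le>n. \<Sum>b\<le>n. raise1 n (\<lambda>x. f x b) a * g a b)
      = (\<Sum>a\<le>n. \<Sum>b\<le>n. f a b * lower1 n (\<lambda>x. g x b) a)"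
    by (subst (1 2) sum.swap) (simp add: raise1_adjoint)
  show ?thesis
    unfolding pair2_def raise2_def lower2_def
    by (simp add: distrib_left distrib_right sum.distrib 1 raise1_adjoint)
qed

lemma pair2_scale_left: "pair2 n (\<lambda>a b. c * f a b) g = c * pair2 n f g"
  by (simp add: pair2_def sum_distrib_left mult_ac)

lemma lower2_scale: "lower2 n (\<lambda>a b. c * f a b) a b = c * lower2 n f a b"
  by (simp add: lower2_def lower1_def algebra_simps)

lemma raise2_scale: "raise2 n (\<lambda>a b. c * f a b) a b = c * raise2 n f a b"
  by (simp add: raise2_def raise1_def algebra_simps split: nat.split)

text \<open>Functions on all pairs stand for vectors on the grid. The commutator relation
  \<open>raise2_lower2\<close> holds off the grid only because everything vanishes there.\<close>

definition supp2 :: "nat \<Rightarrow> (nat \<Rightarrow> nat \<Rightarrow> complex) \<Rightarrow> bool" where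
  "supp2 n f \<longleftrightarrow> (\<forall>a b. a > n \<or> b > n \<longrightarrow> f a b = 0)"

lemma supp2_lower2: "supp2 n f \<Longrightarrow> supp2 n (lower2 n f)"
  by (auto simp: supp2_def lower2_def lower1_def)

text \<open>The relation [E, F] = H of sl(2); \<open>2 * a - n\<close> is the weight of the basis
  vector with index \<open>a\<close>.\<close>

lemma commutator1:
  assumes "a \<le> n"
  shows "raise1 n (lower1 n f) a - lower1 n (raise1 n f) a = (2 * of_nat a - of_nat n) * f a"
proof -
  have l: "lower1 n (raise1 n f) a = of_nat ((a + 1) * (n - a)) * f a"
    by (simp only: lower1_def raise1_def nat.case mult.assoc[symmetric] ladder_square)
  show ?thesis
  proof (cases a)
    case 0
    then show ?thesis using l by (simp add: raise1_def)
  next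
    case (Suc k)
    have "raise1 n (lower1 n f) a = of_nat (a * (n - k)) * f a"
      by (simp only: Suc lower1_def raise1_def nat.case mult.assoc[symmetric] ladder_square) simp
    then have "raise1 n (lower1 n f) a - lower1 n (raise1 n f) a
        = (of_nat (a * (n - k)) - of_nat ((a + 1) * (n - a))) * f a"
      by (simp only: l left_diff_distrib)
    also have "(of_nat (a * (n - k)) - of_nat ((a + 1) * (n - a)) :: complex) = 2 * of_nat a - of_nat n"
    proof -
      obtain d where n: "n = a + d" using assms le_Suc_ex by blast
      show ?thesis unfolding n Suc by (simp add: algebra_simps)
    qed
    finally show ?thesis .
  qed
qed

lemma raise1_lower1_vanish: "a > n \<Longrightarrow> raise1 n f a = 0" "a \<ge> n \<Longrightarrow> lower1 n f a = 0"
  by (auto simp: raise1_def lower1_def split: nat.split)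

lemma raise1_add: "raise1 n (\<lambda>x. f x + g x) a = raise1 n f a + raise1 n g a"
  by (simp add: raise1_def algebra_simps split: nat.split)

lemma lower1_add: "lower1 n (\<lambda>x. f x + g x) a = lower1 n f a + lower1 n g a"
  by (simp add: lower1_def algebra_simps)

lemma raise1_lower1_commute:
  "raise1 n (\<lambda>x. lower1 n (f x) b) a = lower1 n (\<lambda>y. raise1 n (\<lambda>x. f x y) a) b"
  by (simp add: raise1_def lower1_def mult_ac split: nat.split)

lemma raise2_lower2:
  assumes "supp2 n f"
  shows "raise2 n (lower2 n f) a b
    = lower2 n (raise2 n f) a b + (2 * (of_nat a + of_nat b) - 2 * of_nat n) * f a b"
proof (cases "a \<le> n \<and> b \<le> n")
  case True
  have 1: "raise1 n (lower1 n (\<lambda>x. f x b)) a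
      = lower1 n (raise1 n (\<lambda>x. f x b)) a + (2 * of_nat a - of_nat n) * f a b"
    using commutator1[of a n "\<lambda>x. f x b"] True by (simp add: algebra_simps)
  have 2: "raise1 n (lower1 n (f a)) b
      = lower1 n (raise1 n (f a)) b + (2 * of_nat b - of_nat n) * f a b"
    using commutator1[of b n "f a"] True by (simp add: algebra_simps)
  have 3: "raise1 n (\<lambda>x. lower1 n (f x) b) a = lower1 n (\<lambda>y. raise1 n (\<lambda>x. f x y) a) b"
    by (rule raise1_lower1_commute)
  have 4: "raise1 n (\<lambda>y. lower1 n (\<lambda>x. f x y) a) b = lower1 n (\<lambda>x. raise1 n (f x) b) a"
    by (rule raise1_lower1_commute[of n "\<lambda>y x. f x y"])
  show ?thesis
    unfolding raise2_def lower2_def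
    by (simp add: raise1_add lower1_add 1 2 3 4 algebra_simps)
next
  case False
  with assms show ?thesis
    by (auto simp: raise2_def lower2_def raise1_lower1_vanish raise1_def lower1_def supp2_def
        split: nat.split)
qed

text \<open>The highest weight vector of spin \<open>J\<close>: up to a factor, the coefficients of the polynomial
  \<open>(x\<^sub>1 y\<^sub>2 - x\<^sub>2 y\<^sub>1)^(n - J) (x\<^sub>1 x\<^sub>2)^J\<close> in the orthonormal basis.\<close>

definition hw :: "nat \<Rightarrow> nat \<Rightarrow> nat \<Rightarrow> nat \<Rightarrow> complex" where
  "hw n J a b = (if a \<le> n \<and> b \<le> n \<and> a + b = n + J
     then (-1) ^ a * complex_of_real (sqrt (fact a * fact b / (fact (n - a) * fact (n - b)))) else 0)"

lemma supp2_hw: "supp2 n (hw n J)"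
  by (auto simp: supp2_def hw_def)

lemma ladder_hw:
  assumes "k < n" "b \<le> n"
  shows "ladder n k * complex_of_real (sqrt (fact k * fact b / (fact (n - k) * fact (n - b))))
    = complex_of_real (sqrt (fact (Suc k) * fact b / (fact (n - Suc k) * fact (n - b))))"
proof -
  have n: "n - k = Suc (n - Suc k)" using assms by simp
  have "real ((k + 1) * (n - k)) * (fact k * fact b / (fact (n - k) * fact (n - b)))
      = fact (Suc k) * fact b / (fact (n - Suc k) * fact (n - b))"
    unfolding n fact_Suc of_nat_mult by (simp add: divide_simps mult_ac del: of_nat_Suc)
  then show ?thesis
    unfolding ladder_def by (simp only: of_real_mult[symmetric] real_sqrt_mult[symmetric])
qed

text \<open>By \<open>ladder_hw\<close> the two contributions carry the same square root, and the
  sign \<open>(-1) ^ a\<close> in \<open>hw\<close> makes them opposite.\<close>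

lemma raise2_hw: "raise2 n (hw n J) a b = 0"
proof (cases "a \<le> n \<and> b \<le> n \<and> a + b = n + J + 1")
  case True
  then obtain k l where kl: "a = Suc k" "b = Suc l" by (cases a; cases b) auto
  have 1: "ladder n k * hw n J k b =
     (-1) ^ k * complex_of_real (sqrt (fact (Suc k) * fact b / (fact (n - Suc k) * fact (n - b))))"
    using True kl ladder_hw[of k n b] by (simp add: hw_def mult_ac)
  have 2: "ladder n l * hw n J a l =
     (-1) ^ a * complex_of_real (sqrt (fact (Suc l) * fact a / (fact (n - Suc l) * fact (n - a))))"
    using True kl ladder_hw[of l n a] by (simp add: hw_def mult_ac)
  show ?thesis
    unfolding raise2_def raise1_def using 1 2 kl by (simp add: mult_ac)
next
  case False
  have "ladder n k * hw n J k b = 0" if "a = Suc k" for k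
    using False that by (cases "k < n") (auto simp: hw_def)
  moreover have "ladder n k * hw n J a k = 0" if "b = Suc k" for k
    using False that by (cases "k < n") (auto simp: hw_def)
  ultimately show ?thesis
    unfolding raise2_def raise1_def by (auto split: nat.split)
qed

section \<open>Lowering chains of the highest weight vectors\<close>

definition cg_raw :: "nat \<Rightarrow> nat \<Rightarrow> nat \<Rightarrow> nat \<Rightarrow> nat \<Rightarrow> complex" where
  "cg_raw n J k = (lower2 n ^^ k) (hw n J)"

lemma cg_raw_0: "cg_raw n J 0 = hw n J" and cg_raw_Suc: "cg_raw n J (Suc k) = lower2 n (cg_raw n J k)"
  by (simp_all add: cg_raw_def)

lemma supp2_cg_raw: "supp2 n (cg_raw n J k)"
  by (induction k) (simp_all add: cg_raw_0 cg_raw_Suc supp2_hw supp2_lower2)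

lemma cnj_cg_raw: "cnj (cg_raw n J k a b) = cg_raw n J k a b"
  by (induction k arbitrary: a b) (simp_all add: cg_raw_0 cg_raw_Suc hw_def lower2_def lower1_def)

lemma weight_cg_raw: "a + b + k \<noteq> n + J \<Longrightarrow> cg_raw n J k a b = 0"
  by (induction k arbitrary: a b) (simp_all add: cg_raw_0 cg_raw_Suc hw_def lower2_def lower1_def)

text \<open>Commuting the raising operator through one more lowering adds the weight of the vector
  reached so far, and these weights sum to the stated factor. The subtraction is complex, not
  truncated, so the factor is zero exactly at \<open>k = 2 * J\<close>.\<close>

lemma raise2_cg_raw:
  "raise2 n (cg_raw n J (Suc k)) a b
    = of_nat (k + 1) * (2 * of_nat J - of_nat k) * cg_raw n J k a b"
proof (induction k arbitrary: a b)
  case 0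
  have z: "raise2 n (hw n J) = (\<lambda>a b. 0)" by (intro ext) (rule raise2_hw)
  have "raise2 n (lower2 n (hw n J)) a b = (2 * (of_nat a + of_nat b) - 2 * of_nat n) * hw n J a b"
    by (subst raise2_lower2[OF supp2_hw]) (simp add: z lower2_def lower1_def)
  also have "\<dots> = 2 * of_nat J * hw n J a b"
  proof (cases "a + b = n + J")
    case True
    then have "(of_nat a + of_nat b :: complex) = of_nat n + of_nat J"
      by (metis of_nat_add)
    then show ?thesis by simp
  qed (simp add: hw_def)
  finally show ?case by (simp add: cg_raw_0 cg_raw_Suc)
next
  case (Suc k)
  have z: "raise2 n (cg_raw n J (Suc k))
      = (\<lambda>a b. (of_nat (k + 1) * (2 * of_nat J - of_nat k)) * cg_raw n J k a b)"
    by (intro ext) (rule Suc.IH)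
  have "raise2 n (lower2 n (cg_raw n J (Suc k))) a b
    = (of_nat (k + 1) * (2 * of_nat J - of_nat k)) * cg_raw n J (Suc k) a b
      + (2 * (of_nat a + of_nat b) - 2 * of_nat n) * cg_raw n J (Suc k) a b"
    by (subst raise2_lower2[OF supp2_cg_raw], subst z, subst lower2_scale) (simp only: cg_raw_Suc)
  also have "\<dots> = (of_nat (k + 1) * (2 * of_nat J - of_nat k)
      + 2 * (of_nat J - of_nat (Suc k))) * cg_raw n J (Suc k) a b"
  proof (cases "a + b + Suc k = n + J")
    case True
    then have "(of_nat a + of_nat b + of_nat (Suc k) :: complex) = of_nat n + of_nat J"
      by (metis of_nat_add)
    then have e: "(of_nat a + of_nat b :: complex) = of_nat n + (of_nat J - of_nat (Suc k))"
      unfolding eq_diff_eq add_diff_eq .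
    show ?thesis unfolding e by (simp only: ring_distribs) simp
  qed (simp add: weight_cg_raw)
  also have "of_nat (k + 1) * (2 * of_nat J - of_nat k) + 2 * (of_nat J - of_nat (Suc k))
      = (of_nat (Suc k + 1) * (2 * of_nat J - of_nat (Suc k)) :: complex)"
    by (simp add: algebra_simps)
  finally show ?case by (simp only: cg_raw_Suc[of n J "Suc k"])
qed

lemma pair2_cg_raw_Suc:
  "pair2 n (cg_raw n J (Suc k)) (cg_raw n J' (Suc l))
    = of_nat (k + 1) * (2 * of_nat J - of_nat k) * pair2 n (cg_raw n J k) (cg_raw n J' l)"
proof -
  have z: "raise2 n (cg_raw n J (Suc k))
      = (\<lambda>a b. (of_nat (k + 1) * (2 * of_nat J - of_nat k)) * cg_raw n J k a b)"
    by (intro ext) (rule raise2_cg_raw)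
  show ?thesis
    by (simp only: cg_raw_Suc[of n J' l] pair2_raise[symmetric] z pair2_scale_left)
qed

text \<open>\<open>pair2_cg_raw_Suc\<close> strips one lowering from both sides until the left
  vector is of highest weight; one more lowering moved across then raises it to zero.\<close>

lemma pair2_cg_raw_less: "k < l \<Longrightarrow> pair2 n (cg_raw n J k) (cg_raw n J' l) = 0"
proof (induction k arbitrary: l)
  case 0
  then obtain m where l: "l = Suc m" by (cases l) auto
  have z: "raise2 n (hw n J) = (\<lambda>a b. 0)" by (intro ext) (rule raise2_hw)
  show ?case
    unfolding l cg_raw_0 cg_raw_Suc pair2_raise[symmetric] z by (simp add: pair2_def)
next
  case (Suc k)
  then obtain m where l: "l = Suc m" "k < m" by (cases l) auto
  show ?case unfolding l pair2_cg_raw_Suc using Suc.IH[OF l(2)] by simp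
qed

text \<open>Different depths are settled by \<open>pair2_cg_raw_less\<close>. Equal depth with
  different spins means different total weight \<open>a + b\<close>, hence disjoint
  supports.\<close>

lemma pair2_cg_raw_orthogonal:
  assumes "(J, k) \<noteq> (J', l)"
  shows "pair2 n (cg_raw n J k) (cg_raw n J' l) = 0"
proof -
  consider "k < l" | "l < k" | "k = l" "J \<noteq> J'" using assms by fastforce
  then show ?thesis
  proof cases
    case 3
    have "cg_raw n J k a b * cg_raw n J' l a b = 0" for a b
      using weight_cg_raw[of a b k n J] weight_cg_raw[of a b k n J'] 3 by fastforce
    then show ?thesis unfolding pair2_def by (intro sum.neutral ballI)
  qed (simp add: pair2_cg_raw_less, subst pair2_commute, simp add: pair2_cg_raw_less)
qed

definition cg_sqnorm :: "nat \<Rightarrow> nat \<Rightarrow> nat \<Rightarrow> real" where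
  "cg_sqnorm n J k = (\<Sum>a\<le>n. \<Sum>b\<le>n. (cmod (cg_raw n J k a b))\<^sup>2)"

lemma pair2_cg_raw_self: "pair2 n (cg_raw n J k) (cg_raw n J k) = complex_of_real (cg_sqnorm n J k)"
proof -
  have "cg_raw n J k a b * cg_raw n J k a b = complex_of_real ((cmod (cg_raw n J k a b))\<^sup>2)" for a b
    by (metis cnj_cg_raw complex_norm_square)
  then show ?thesis by (simp add: pair2_def cg_sqnorm_def)
qed

lemma cg_sqnorm_Suc: "cg_sqnorm n J (Suc k) = real (k + 1) * (2 * real J - real k) * cg_sqnorm n J k"
proof -
  have "complex_of_real (cg_sqnorm n J (Suc k))
      = of_nat (k + 1) * (2 * of_nat J - of_nat k) * complex_of_real (cg_sqnorm n J k)"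
    by (simp only: pair2_cg_raw_self[symmetric] pair2_cg_raw_Suc)
  also have "\<dots> = complex_of_real (real (k + 1) * (2 * real J - real k) * cg_sqnorm n J k)"
    by simp
  finally show ?thesis by (simp only: of_real_eq_iff)
qed

lemma cg_sqnorm_pos: "J \<le> n \<Longrightarrow> k \<le> 2 * J \<Longrightarrow> cg_sqnorm n J k > 0"
proof (induction k)
  case 0
  have "0 < (cmod (cg_raw n J 0 n J))\<^sup>2"
    using 0 by (simp add: cg_raw_0 hw_def)
  also have "\<dots> \<le> (\<Sum>b\<le>n. (cmod (cg_raw n J 0 n b))\<^sup>2)"
    by (rule member_le_sum) (use 0 in auto)
  also have "\<dots> \<le> cg_sqnorm n J 0"
    unfolding cg_sqnorm_def
    by (rule member_le_sum[of n "{..n}" "\<lambda>a. \<Sum>b\<le>n. (cmod (cg_raw n J 0 a b))\<^sup>2"])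
      (auto intro: sum_nonneg)
  finally show ?case .
next
  case (Suc k)
  then have "cg_sqnorm n J k > 0" "2 * real J - real k > 0" by auto
  then show ?case unfolding cg_sqnorm_Suc by (intro mult_pos_pos) auto
qed

text \<open>The norm recursion has the factor \<open>2 * J - k\<close>, which vanishes at
  \<open>k = 2 * J\<close>; a vector of norm zero is zero, so the chain has length
  \<open>2 * J + 1\<close>.\<close>

lemma cg_raw_top: "cg_raw n J (Suc (2 * J)) a b = 0"
proof (cases "a \<le> n \<and> b \<le> n")
  case True
  have z: "cg_sqnorm n J (Suc (2 * J)) = 0" by (simp add: cg_sqnorm_Suc)
  have "(cmod (cg_raw n J (Suc (2 * J)) a b))\<^sup>2 \<le> (\<Sum>b\<le>n. (cmod (cg_raw n J (Suc (2 * J)) a b))\<^sup>2)"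
    by (rule member_le_sum) (use True in auto)
  also have "\<dots> \<le> cg_sqnorm n J (Suc (2 * J))"
    unfolding cg_sqnorm_def
    by (rule member_le_sum[of a "{..n}" "\<lambda>a. \<Sum>b\<le>n. (cmod (cg_raw n J (Suc (2 * J)) a b))\<^sup>2"])
      (use True in \<open>auto intro: sum_nonneg\<close>)
  finally show ?thesis using z by simp
next
  case False
  then show ?thesis using supp2_cg_raw[of n J "Suc (2 * J)"] by (auto simp: supp2_def)
qed

text \<open>The Clebsch-Gordan coefficients of two equal spins, up to a sign for each
  \<open>J\<close>; \<open>k\<close> counts the steps down from the highest weight, so the magnetic
  number is \<open>J - k\<close>.\<close>

definition cg :: "nat \<Rightarrow> nat \<Rightarrow> nat \<Rightarrow> nat \<Rightarrow> nat \<Rightarrow> complex" where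
  "cg n J k a b = complex_of_real (1 / sqrt (cg_sqnorm n J k)) * cg_raw n J k a b"

lemma cnj_cg [simp]: "cnj (cg n J k a b) = cg n J k a b"
  by (simp add: cg_def cnj_cg_raw)

lemma supp2_cg: "supp2 n (cg n J k)"
  using supp2_cg_raw by (auto simp: supp2_def cg_def)

lemma weight_cg: "a + b + k \<noteq> n + J \<Longrightarrow> cg n J k a b = 0"
  by (simp add: cg_def weight_cg_raw)

text \<open>After normalisation each chain is a standard spin module with the ladder entries of
  \<open>2 * J\<close> in place of \<open>n\<close>. The end \<open>k = 2 * J\<close> is included
  because \<open>ladder (2 * J) (2 * J)\<close> is zero, in accordance with
  \<open>cg_raw_top\<close>.\<close>

lemma lower2_cg:
  assumes "J \<le> n" "k \<le> 2 * J"
  shows "lower2 n (cg n J k) a b = ladder (2 * J) k * cg n J (Suc k) a b"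
proof (cases "k = 2 * J")
  case True
  have "lower2 n (cg n J k) a b = complex_of_real (1 / sqrt (cg_sqnorm n J k)) * cg_raw n J (Suc k) a b"
    unfolding cg_def[abs_def] cg_raw_Suc by (rule lower2_scale)
  then show ?thesis by (simp add: True cg_raw_top)
next
  case False
  define r where "r = real ((k + 1) * (2 * J - k))"
  have r': "r = real (k + 1) * (2 * real J - real k)"
    unfolding r_def of_nat_mult using assms by (simp add: of_nat_diff)
  have r: "r > 0" and c: "cg_sqnorm n J (Suc k) = r * cg_sqnorm n J k" and p: "cg_sqnorm n J k > 0"
    using False assms cg_sqnorm_pos[of J n k] by (simp_all add: r' cg_sqnorm_Suc)
  have "lower2 n (cg n J k) a b = complex_of_real (1 / sqrt (cg_sqnorm n J k)) * cg_raw n J (Suc k) a b"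
    unfolding cg_def[abs_def] cg_raw_Suc by (rule lower2_scale)
  also have "1 / sqrt (cg_sqnorm n J k) = sqrt r * (1 / sqrt (cg_sqnorm n J (Suc k)))"
    using r p by (simp add: c real_sqrt_mult field_simps)
  finally show ?thesis
    unfolding ladder_def r_def[symmetric] of_real_mult cg_def[abs_def] by (simp only: mult.assoc)
qed

lemma raise2_cg:
  assumes "J \<le> n" "k < 2 * J"
  shows "raise2 n (cg n J (Suc k)) a b = ladder (2 * J) k * cg n J k a b"
proof -
  define r where "r = real ((k + 1) * (2 * J - k))"
  have r': "r = real (k + 1) * (2 * real J - real k)"
    unfolding r_def of_nat_mult using assms by (simp add: of_nat_diff)
  have r: "r > 0" and c: "cg_sqnorm n J (Suc k) = r * cg_sqnorm n J k" and p: "cg_sqnorm n J k > 0"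
    using assms cg_sqnorm_pos[of J n k] by (simp_all add: r' cg_sqnorm_Suc)
  have rr: "of_nat (k + 1) * (2 * of_nat J - of_nat k) = complex_of_real r"
    unfolding r' by simp
  have "raise2 n (cg n J (Suc k)) a b = complex_of_real (1 / sqrt (cg_sqnorm n J (Suc k)) * r) * cg_raw n J k a b"
    unfolding cg_def[abs_def] raise2_scale raise2_cg_raw rr by simp
  also have "1 / sqrt (cg_sqnorm n J (Suc k)) * r = sqrt r * (1 / sqrt (cg_sqnorm n J k))"
    using r p by (simp add: c real_sqrt_mult field_simps)
  finally show ?thesis
    unfolding ladder_def r_def[symmetric] of_real_mult cg_def[abs_def] by (simp only: mult.assoc)
qed

lemma raise2_cg_0: "raise2 n (cg n J 0) a b = 0"
  unfolding cg_def[abs_def] raise2_scale cg_raw_0 by (simp add: raise2_hw)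

definition cgidx :: "nat \<Rightarrow> (nat \<times> nat) set" where
  "cgidx n = (SIGMA J:{..n}. {..2 * J})"

lemma finite_cgidx [simp]: "finite (cgidx n)"
  by (simp add: cgidx_def)

text \<open>A sum of consecutive odd numbers. It equals the dimension of the two-fold tensor
  product, which is what turns orthonormality into completeness.\<close>

lemma card_cgidx: "card (cgidx n) = (n + 1) * (n + 1)"
proof -
  have "card (cgidx n) = (\<Sum>J\<le>n. 2 * J + 1)"
    unfolding cgidx_def by (subst card_SigmaI) auto
  also have "\<dots> = (n + 1) * (n + 1)" by (induction n) auto
  finally show ?thesis .
qed

lemma cg_orthonormal:
  assumes "(J, k) \<in> cgidx n" "(J', l) \<in> cgidx n"
  shows "pair2 n (cg n J k) (cg n J' l) = (if (J, k) = (J', l) then 1 else 0)"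
proof -
  have "pair2 n (cg n J k) (cg n J' l) = complex_of_real (1 / sqrt (cg_sqnorm n J k) * (1 / sqrt (cg_sqnorm n J' l)))
      * pair2 n (cg_raw n J k) (cg_raw n J' l)"
    unfolding pair2_def cg_def by (simp add: sum_distrib_left mult_ac)
  moreover have "cg_sqnorm n J k > 0" using assms by (intro cg_sqnorm_pos) (auto simp: cgidx_def)
  ultimately show ?thesis
    using pair2_cg_raw_orthogonal[of J k J' l n]
    by (cases "(J, k) = (J', l)") (auto simp: pair2_cg_raw_self simp flip: of_real_mult real_sqrt_mult)
qed

text \<open>Summing the residuals in Bessel's inequality over all basis vectors gives
  \<open>card B - card S = 0\<close>, so every residual vanishes.\<close>

lemma orthonormal_complete:
  fixes u :: "'s \<Rightarrow> 'b \<Rightarrow> complex"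
  assumes fin: "finite S" "finite B" and card: "card S = card B"
    and on: "\<And>s t. s \<in> S \<Longrightarrow> t \<in> S \<Longrightarrow> (\<Sum>b\<in>B. u s b * cnj (u t b)) = (if s = t then 1 else 0)"
    and "b \<in> B" "b' \<in> B"
  shows "(\<Sum>s\<in>S. u s b * cnj (u s b')) = (if b = b' then 1 else 0)"
proof -
  define r where "r = (\<lambda>b b'. (if b = b' then 1 else 0) - (\<Sum>s\<in>S. cnj (u s b) * u s b'))"
  have norm: "(\<Sum>b'\<in>B. r b b' * cnj (r b b')) = 1 - (\<Sum>s\<in>S. u s b * cnj (u s b))" if b: "b \<in> B" for b
  proof -
    have e: "r b b' * cnj (r b b') = (if b = b' then 1 - (\<Sum>s\<in>S. cnj (u s b) * u s b') - (\<Sum>s\<in>S. u s b * cnj (u s b')) else 0)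
       + (\<Sum>s\<in>S. \<Sum>t\<in>S. cnj (u s b) * u t b * (u s b' * cnj (u t b')))" for b'
      by (simp add: r_def algebra_simps sum_product)
    have "(\<Sum>b'\<in>B. \<Sum>s\<in>S. \<Sum>t\<in>S. cnj (u s b) * u t b * (u s b' * cnj (u t b')))
        = (\<Sum>s\<in>S. \<Sum>t\<in>S. cnj (u s b) * u t b * (\<Sum>b'\<in>B. u s b' * cnj (u t b')))"
      by (subst sum.swap, rule sum.cong[OF refl], subst sum.swap) (simp add: sum_distrib_left)
    also have "\<dots> = (\<Sum>s\<in>S. \<Sum>t\<in>S. if s = t then cnj (u s b) * u t b else 0)"
      by (intro sum.cong refl) (simp add: on)
    also have "\<dots> = (\<Sum>s\<in>S. cnj (u s b) * u s b)"
      by (simp add: fin)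
    finally show ?thesis
      unfolding e sum.distrib using b fin by (simp add: mult.commute)
  qed
  have re: "r b b' * cnj (r b b') = complex_of_real ((cmod (r b b'))\<^sup>2)" for b b'
    by (rule complex_norm_square[symmetric])
  have "complex_of_real (\<Sum>b\<in>B. \<Sum>b'\<in>B. (cmod (r b b'))\<^sup>2) = (\<Sum>b\<in>B. \<Sum>b'\<in>B. r b b' * cnj (r b b'))"
    by (simp add: re)
  also have "\<dots> = of_nat (card B) - (\<Sum>b\<in>B. \<Sum>s\<in>S. u s b * cnj (u s b))"
    by (simp add: norm sum_subtractf)
  also have "(\<Sum>b\<in>B. \<Sum>s\<in>S. u s b * cnj (u s b)) = (\<Sum>s\<in>S. 1)"
    by (subst sum.swap) (simp add: on)
  finally have "(\<Sum>b\<in>B. \<Sum>b'\<in>B. (cmod (r b b'))\<^sup>2) = 0"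
    using card by (simp del: of_real_sum)
  then have "\<forall>b\<in>B. (\<Sum>b'\<in>B. (cmod (r b b'))\<^sup>2) = 0"
    by (subst (asm) sum_nonneg_eq_0_iff) (auto simp: fin intro: sum_nonneg)
  then have "r b b' = 0" if "b \<in> B" "b' \<in> B" for b b'
    using that by (simp add: sum_nonneg_eq_0_iff fin)
  from this[of b' b] assms show ?thesis
    by (auto simp: r_def mult.commute)
qed

lemma cg_complete:
  assumes "a \<le> n" "b \<le> n" "a' \<le> n" "b' \<le> n"
  shows "(\<Sum>(J, k)\<in>cgidx n. cg n J k a b * cg n J k a' b') = (if a = a' \<and> b = b' then 1 else 0)"
proof -
  have "(\<Sum>s\<in>cgidx n. (\<lambda>(J, k) (a, b). cg n J k a b) s (a, b) * cnj ((\<lambda>(J, k) (a, b). cg n J k a b) s (a', b')))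
      = (if (a, b) = (a', b') then 1 else 0)"
  proof (rule orthonormal_complete[where B = "{..n} \<times> {..n}"])
    show "card (cgidx n) = card ({..n} \<times> {..n})" by (simp add: card_cgidx)
    fix s t assume "s \<in> cgidx n" "t \<in> cgidx n"
    moreover obtain J k J' l where "s = (J, k)" "t = (J', l)" by (cases s; cases t)
    ultimately show "(\<Sum>b\<in>{..n} \<times> {..n}. (case s of (J, k) \<Rightarrow> \<lambda>(a, b). cg n J k a b) b *
              cnj ((case t of (J, k) \<Rightarrow> \<lambda>(a, b). cg n J k a b) b)) = (if s = t then 1 else 0)"
      using cg_orthonormal[of J k n J' l]
      by (simp add: pair2_def sum.cartesian_product case_prod_unfold)
  qed (use assms in auto)
  then show ?thesis by (simp add: case_prod_unfold)
qed

section \<open>Invariance under the group and under its Lie algebra\<close>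

text \<open>Every element of \<open>SU2\<close> lies on such a curve, which starts at a diagonal matrix and moves by right
  multiplication with a one-parameter group. Differentiating along it therefore needs
  no multiplicativity of \<open>spin_rep\<close>.\<close>

definition su2_curve :: "complex \<Rightarrow> complex \<Rightarrow> real \<Rightarrow> complex^2^2" where
  "su2_curve p q t = vector [vector [p * cos t, q * sin t],
     vector [- cnj q * sin t, cnj p * cos t]]"

lemma su2_curve_nth [simp]:
  "su2_curve p q t $ 1 $ 1 = p * cos t" "su2_curve p q t $ 1 $ 2 = q * sin t"
  "su2_curve p q t $ 2 $ 1 = - cnj q * sin t" "su2_curve p q t $ 2 $ 2 = cnj p * cos t"
  by (simp_all add: su2_curve_def)

lemma unit_complex: "cmod p = 1 \<Longrightarrow> p * cnj p = 1"
  by (simp add: complex_norm_square[symmetric])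

lemma su2_curve_in_SU2:
  assumes "cmod p = 1" "cmod q = 1"
  shows "su2_curve p q t \<in> SU2"
proof -
  note u = unit_complex[OF assms(1)] unit_complex[OF assms(2)]
  have cs: "complex_of_real (cos t) * complex_of_real (cos t)
      + complex_of_real (sin t) * complex_of_real (sin t) = 1"
    unfolding of_real_mult[symmetric] of_real_add[symmetric] by (simp flip: power2_eq_square)
  have s: "complex_of_real (sin t) * complex_of_real (sin t)
      = 1 - complex_of_real (cos t) * complex_of_real (cos t)"
    using cs by (simp add: algebra_simps)
  have 1: "p * x * (cnj p * y) = x * y" "q * x * (cnj q * y) = x * y"
      "cnj p * x * (p * y) = x * y" "cnj q * x * (q * y) = x * y" for x y
    using u by (metis mult.assoc mult.commute mult.left_neutral mult.left_commute)+
  show ?thesis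
    unfolding SU2_def mem_Collect_eq
    by (simp add: vec_eq_iff forall_2 matrix_matrix_mult_def sum_2 mat_def det_2 1 s)
qed

text \<open>Unitarity and the determinant force the second row to be \<open>- cnj y, cnj x\<close>.
  The squared moduli of \<open>x\<close> and \<open>y\<close> add up to 1, which provides the angle
  \<open>t\<close>; \<open>p\<close> and \<open>q\<close> are the phases.\<close>

lemma SU2_on_curve:
  assumes "g \<in> SU2"
  obtains p q t where "cmod p = 1" "cmod q = 1" "g = su2_curve p q t"
proof -
  define x y z w where "x = g $ 1 $ 1" and "y = g $ 1 $ 2" and "z = g $ 2 $ 1" and "w = g $ 2 $ 2"
  from assms have U: "g ** (\<chi> i k. cnj (g $ k $ i)) = mat 1" and d: "det g = 1"
    by (auto simp: SU2_def)
  from U have n1: "x * cnj x + y * cnj y = 1" and o: "x * cnj z + y * cnj w = 0"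
    by (simp_all add: vec_eq_iff forall_2 matrix_matrix_mult_def sum_2 mat_def x_def y_def z_def w_def)
  from d have d: "x * w - y * z = 1"
    by (simp add: det_2 x_def y_def z_def w_def)
  have o': "cnj x * z + cnj y * w = 0"
    using arg_cong[OF o, of cnj] by simp
  have w: "w = cnj x"
  proof -
    have "w = (x * cnj x + y * cnj y) * w" using n1 by simp
    also have "\<dots> = cnj x * (x * w - y * z) + y * (cnj x * z + cnj y * w)"
      by (simp add: algebra_simps)
    finally show ?thesis using d o' by simp
  qed
  have z: "z = - cnj y"
  proof -
    have "z = (x * cnj x + y * cnj y) * z" using n1 by simp
    also have "\<dots> = x * (cnj x * z + cnj y * w) - cnj y * (x * w - y * z)"
      by (simp add: algebra_simps)
    finally show ?thesis using d o' by simp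
  qed
  have "complex_of_real ((cmod x)\<^sup>2 + (cmod y)\<^sup>2) = 1"
    unfolding of_real_add complex_norm_square by (rule n1)
  then have "(cmod x)\<^sup>2 + (cmod y)\<^sup>2 = 1" by (simp only: of_real_eq_1_iff)
  then obtain t where t: "cmod x = cos t" "cmod y = sin t"
    using sincos_total_2pi by blast
  \<comment> \<open>A zero entry has no phase of its own, so 1 is taken.\<close>
  have polar: "\<exists>p. cmod p = 1 \<and> x = p * cmod x" for x :: complex
    by (intro exI[of _ "if x = 0 then 1 else sgn x"]) (simp add: sgn_eq norm_divide)
  obtain p q where p: "cmod p = 1" "x = p * cos t" and q: "cmod q = 1" "y = q * sin t"
    using polar[of x] polar[of y] t by auto
  have "g = su2_curve p q t"
    using w z unfolding vec_eq_iff forall_2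
    by (simp add: x_def[symmetric] y_def[symmetric] z_def[symmetric] w_def[symmetric] p q)
  then show ?thesis using that p q by blast
qed

section \<open>Differentiating the spin representation along a curve\<close>

definition coeff_deriv :: "(real \<Rightarrow> complex poly) \<Rightarrow> complex poly \<Rightarrow> real \<Rightarrow> bool" where
  "coeff_deriv p p' t \<longleftrightarrow>
     (\<forall>m. ((\<lambda>t. coeff (p t) m) has_vector_derivative coeff p' m) (at t))"

lemma coeff_deriv_mult:
  assumes "coeff_deriv p p' t" "coeff_deriv q q' t"
  shows "coeff_deriv (\<lambda>t. p t * q t) (p t * q' + p' * q t) t"
  unfolding coeff_deriv_def coeff_mult coeff_add sum.distrib[symmetric]
  using assms by (intro allI has_vector_derivative_sum has_vector_derivative_mult)
    (auto simp: coeff_deriv_def)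

lemma coeff_deriv_power:
  assumes "coeff_deriv p p' t"
  shows "coeff_deriv (\<lambda>t. p t ^ k) (smult (of_nat k) (p t ^ (k - 1) * p')) t"
proof (induction k)
  case 0
  then show ?case by (simp add: coeff_deriv_def)
next
  case (Suc k)
  have S: "smult (of_nat (Suc j)) r = r + smult (of_nat j) r" for j and r :: "complex poly"
    by (simp add: smult_add_left)
  have "p t * smult (of_nat k) (p t ^ (k - 1) * p') + p' * p t ^ k
      = smult (of_nat (Suc k)) (p t ^ (Suc k - 1) * p')"
    by (cases k) (simp_all add: S distrib_left mult_ac del: of_nat_Suc)
  then show ?case
    using coeff_deriv_mult[OF assms Suc] by simp
qed

text \<open>The product rule yields the integer factors \<open>n - k\<close> and \<open>k\<close>.
  In the orthonormal basis, whose normalisation constants differ between neighbouring indices, they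
  turn into the symmetric ladder entries; \<open>c\<close> stands for the factorials of the row
  index.\<close>

lemma norm_const_ladder:
  assumes "k < n"
  shows "of_nat (n - k) * complex_of_real (sqrt (c / (fact k * fact (n - k))))
      = ladder n k * complex_of_real (sqrt (c / (fact (Suc k) * fact (n - Suc k))))"
    and "of_nat (Suc k) * complex_of_real (sqrt (c / (fact (Suc k) * fact (n - Suc k))))
      = ladder n k * complex_of_real (sqrt (c / (fact k * fact (n - k))))"
proof -
  have n: "n - k = Suc (n - Suc k)" using assms by simp
  have alg: "x * x * (c / (K * (x * L))) = y * x * (c / (y * K * L))"
    if "x > 0" "y > 0" "K > 0" "L > 0" for x y K L :: real
    using that by (simp add: divide_simps)
  have alg': "y * y * (c / (y * K * L)) = y * x * (c / (K * (x * L)))"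
    if "x > 0" "y > 0" "K > 0" "L > 0" for x y K L :: real
    using that by (simp add: divide_simps)
  have lift: "of_nat m * complex_of_real (sqrt u) = ladder n k * complex_of_real (sqrt v)"
    if "real m * real m * u = real (Suc k) * real (n - k) * v" for m u v
  proof -
    have e: "real ((k + 1) * (n - k)) * v = real m * real m * u"
      using that by (simp add: distrib_right)
    have "real m * sqrt u = sqrt (real m * real m * u)"
      by (simp add: real_sqrt_mult)
    also have "\<dots> = sqrt (real ((k + 1) * (n - k))) * sqrt v"
      by (simp only: real_sqrt_mult[symmetric] e)
    finally have "real m * sqrt u = sqrt (real ((k + 1) * (n - k))) * sqrt v" .
    from arg_cong[OF this, of complex_of_real] show ?thesis
      unfolding ladder_def by (simp only: of_real_mult of_real_of_nat_eq)
  qed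
  show "of_nat (n - k) * complex_of_real (sqrt (c / (fact k * fact (n - k))))
      = ladder n k * complex_of_real (sqrt (c / (fact (Suc k) * fact (n - Suc k))))"
    by (rule lift, unfold n fact_Suc, rule alg) simp_all
  show "of_nat (Suc k) * complex_of_real (sqrt (c / (fact (Suc k) * fact (n - Suc k))))
      = ladder n k * complex_of_real (sqrt (c / (fact k * fact (n - k))))"
    by (rule lift, unfold n fact_Suc, rule alg') simp_all
qed

text \<open>The columns of the curve, read as linear polynomials \<open>A\<close> and
  \<open>B\<close>, satisfy A' = - cnj w B and B' = w A with the constant
  \<open>w = q * cnj p\<close>. The derivative of \<open>A ^ k * B ^ (n - k)\<close> therefore
  involves only the neighbouring columns \<open>k + 1\<close> and \<open>k - 1\<close>.\<close>

lemma spin_rep_deriv: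
  assumes "cmod p = 1" "cmod q = 1" "k \<le> n"
  shows "((\<lambda>t. spin_rep n (su2_curve p q t) m k) has_vector_derivative
     (q * cnj p) * lower1 n (spin_rep n (su2_curve p q t) m) k
     - cnj (q * cnj p) * raise1 n (spin_rep n (su2_curve p q t) m) k) (at t)"
proof -
  define w where "w = q * cnj p"
  define A where "A = (\<lambda>t. [:- cnj q * complex_of_real (sin t), p * complex_of_real (cos t):])"
  define B where "B = (\<lambda>t. [:cnj p * complex_of_real (cos t), q * complex_of_real (sin t):])"
  define c where "c = (\<lambda>k. complex_of_real (sqrt (fact m * fact (n - m) / (fact k * fact (n - k)))))"
  note u = unit_complex[OF assms(1)] unit_complex[OF assms(2)]
  have u': "cnj q * (p * (cnj p * x)) = cnj q * x" "cnj q * (p * (q * x)) = p * x"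
    "q * (cnj p * (cnj q * x)) = cnj p * x" "q * (cnj p * (p * x)) = q * x" for x
    using u by (metis mult.assoc mult.commute mult.left_neutral mult.left_commute)+
  have S: "spin_rep n (su2_curve p q t) m k = c k * coeff (A t ^ k * B t ^ (n - k)) m" for t k
    by (simp add: spin_rep_def c_def A_def B_def)
  have A': "coeff_deriv A (smult (- cnj w) (B t)) t"
    unfolding coeff_deriv_def
  proof
    fix m
    show "((\<lambda>t. coeff (A t) m) has_vector_derivative coeff (smult (- cnj w) (B t)) m) (at t)"
      by (cases "m = 0"; cases "m = 1")
        (auto simp: A_def B_def w_def coeff_pCons mult_ac u u' split: nat.splits
          intro!: derivative_eq_intros has_vector_derivative_of_real)
  qed
  have B': "coeff_deriv B (smult w (A t)) t"
    unfolding coeff_deriv_def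
  proof
    fix m
    show "((\<lambda>t. coeff (B t) m) has_vector_derivative coeff (smult w (A t)) m) (at t)"
      by (cases "m = 0"; cases "m = 1")
        (auto simp: A_def B_def w_def coeff_pCons mult_ac u u' split: nat.splits
          intro!: derivative_eq_intros has_vector_derivative_of_real)
  qed
  have D: "coeff_deriv (\<lambda>t. A t ^ k * B t ^ (n - k))
     (A t ^ k * smult (of_nat (n - k)) (B t ^ (n - k - 1) * smult w (A t))
      + smult (of_nat k) (A t ^ (k - 1) * smult (- cnj w) (B t)) * B t ^ (n - k)) t"
    by (intro coeff_deriv_mult coeff_deriv_power A' B')
  have low: "c k * coeff (A t ^ k * smult (of_nat (n - k)) (B t ^ (n - k - 1) * smult w (A t))) m
      = w * lower1 n (spin_rep n (su2_curve p q t) m) k"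
  proof (cases "k < n")
    case True
    have "c k * coeff (A t ^ k * smult (of_nat (n - k)) (B t ^ (n - k - 1) * smult w (A t))) m
        = w * (of_nat (n - k) * c k) * coeff (A t ^ Suc k * B t ^ (n - Suc k)) m"
      by (simp add: mult_ac)
    also have "of_nat (n - k) * c k = ladder n k * c (Suc k)"
      unfolding c_def by (rule norm_const_ladder(1)[OF True])
    finally show ?thesis by (simp add: lower1_def S mult_ac)
  next
    case False
    then show ?thesis using assms by (simp add: lower1_def)
  qed
  have up: "c k * coeff (smult (of_nat k) (A t ^ (k - 1) * smult (- cnj w) (B t)) * B t ^ (n - k)) m
      = - cnj w * raise1 n (spin_rep n (su2_curve p q t) m) k"
  proof (cases k)
    case (Suc l)
    then have l: "l < n" and s: "n - l = Suc (n - Suc l)" using assms by auto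
    have "c k * coeff (smult (of_nat k) (A t ^ (k - 1) * smult (- cnj w) (B t)) * B t ^ (n - k)) m
        = - cnj w * (of_nat (Suc l) * c (Suc l)) * coeff (A t ^ l * B t ^ (n - l)) m"
      unfolding s Suc by (simp add: mult_ac del: of_nat_Suc)
    also have "of_nat (Suc l) * c (Suc l) = ladder n l * c l"
      unfolding c_def by (rule norm_const_ladder(2)[OF l])
    finally show ?thesis by (simp add: raise1_def S Suc mult_ac)
  qed (simp add: raise1_def)
  have "((\<lambda>t. c k * coeff (A t ^ k * B t ^ (n - k)) m) has_vector_derivative
     c k * coeff (A t ^ k * smult (of_nat (n - k)) (B t ^ (n - k - 1) * smult w (A t))
      + smult (of_nat k) (A t ^ (k - 1) * smult (- cnj w) (B t)) * B t ^ (n - k)) m) (at t)"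
    using D by (intro has_vector_derivative_mult_right) (simp add: coeff_deriv_def)
  then show ?thesis
    unfolding S[symmetric] coeff_add distrib_left low up w_def[symmetric] by simp
qed

text \<open>The action on one spin of the Lie algebra matrix with rows (0, w) and (- cnj w, 0).
  Compared with \<open>spin_rep_deriv\<close>, raising and lowering have changed places because the
  operator has been transposed from the matrix row onto the vector.\<close>

definition su2_gen :: "nat \<Rightarrow> complex \<Rightarrow> (nat \<Rightarrow> complex) \<Rightarrow> nat \<Rightarrow> complex" where
  "su2_gen n w f a = w * raise1 n f a - cnj w * lower1 n f a"

lemma su2_gen_sum:
  "su2_gen n w (\<lambda>x. \<Sum>j\<in>I. s j * h x j) a = (\<Sum>j\<in>I. s j * su2_gen n w (\<lambda>x. h x j) a)"
  by (simp add: su2_gen_def raise1_def lower1_def sum_distrib_left right_diff_distrib sum_subtractf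
      mult_ac split: nat.split)

text \<open>Letting \<open>G\<close> depend on \<open>t\<close> makes the rule iterable: each use
  handles one tensor factor of a nested sum and passes the derivative of the inner sum on as
  \<open>G'\<close>.\<close>

lemma spin_rep_sum_deriv:
  assumes "cmod p = 1" "cmod q = 1"
    and G: "\<And>k. k \<le> n \<Longrightarrow> ((\<lambda>t. G t k) has_vector_derivative G' k) (at t)"
  shows "((\<lambda>t. \<Sum>k\<le>n. spin_rep n (su2_curve p q t) m k * G t k) has_vector_derivative
     (\<Sum>k\<le>n. spin_rep n (su2_curve p q t) m k * (G' k + su2_gen n (q * cnj p) (G t) k))) (at t)"
proof -
  let ?S = "spin_rep n (su2_curve p q t) m" and ?w = "q * cnj p"
  have "((\<lambda>t. \<Sum>k\<le>n. spin_rep n (su2_curve p q t) m k * G t k) has_vector_derivative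
     (\<Sum>k\<le>n. ?S k * G' k + (?w * lower1 n ?S k - cnj ?w * raise1 n ?S k) * G t k)) (at t)"
    using assms
    by (intro has_vector_derivative_sum has_vector_derivative_mult spin_rep_deriv G) auto
  also have "(\<Sum>k\<le>n. ?S k * G' k + (?w * lower1 n ?S k - cnj ?w * raise1 n ?S k) * G t k)
      = (\<Sum>k\<le>n. ?S k * G' k) + (?w * (\<Sum>k\<le>n. G t k * lower1 n ?S k) - cnj ?w * (\<Sum>k\<le>n. raise1 n ?S k * G t k))"
    by (simp only: left_diff_distrib right_diff_distrib sum.distrib sum_subtractf sum_distrib_left mult_ac)
  also have "\<dots> = (\<Sum>k\<le>n. ?S k * (G' k + su2_gen n ?w (G t) k))"
    unfolding raise1_adjoint[where f = ?S and g = "G t"]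
      raise1_adjoint[where f = "G t" and g = ?S, symmetric]
    by (simp only: su2_gen_def distrib_left right_diff_distrib sum.distrib sum_subtractf sum_distrib_left mult_ac)
  finally show ?thesis .
qed

lemma diag_action_nested:
  "diag_action n g \<psi> (a, b, c, d) =
    (\<Sum>a'\<le>n. spin_rep n g a a' * (\<Sum>b'\<le>n. spin_rep n g b b' * (\<Sum>c'\<le>n. spin_rep n g c c' *
      (\<Sum>d'\<le>n. spin_rep n g d d' * \<psi> (a', b', c', d')))))"
  unfolding diag_action_def idx4_def sum.cartesian_product[symmetric]
  by (simp add: sum_distrib_left mult.assoc)

definition raise4 :: "nat \<Rightarrow> tensor4 \<Rightarrow> tensor4" where
  "raise4 n \<psi> = (\<lambda>(a, b, c, d). raise2 n (\<lambda>x y. \<psi> (x, y, c, d)) a b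
     + raise2 n (\<lambda>x y. \<psi> (a, b, x, y)) c d)"

definition lower4 :: "nat \<Rightarrow> tensor4 \<Rightarrow> tensor4" where
  "lower4 n \<psi> = (\<lambda>(a, b, c, d). lower2 n (\<lambda>x y. \<psi> (x, y, c, d)) a b
     + lower2 n (\<lambda>x y. \<psi> (a, b, x, y)) c d)"

lemma su2_gen4:
  "w * raise4 n \<psi> (a, b, c, d) - cnj w * lower4 n \<psi> (a, b, c, d) =
     su2_gen n w (\<lambda>x. \<psi> (x, b, c, d)) a + (su2_gen n w (\<lambda>x. \<psi> (a, x, c, d)) b +
     (su2_gen n w (\<lambda>x. \<psi> (a, b, x, d)) c + su2_gen n w (\<lambda>x. \<psi> (a, b, c, x)) d))"
  by (simp add: raise4_def lower4_def raise2_def lower2_def su2_gen_def algebra_simps)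

lemma diag_action_deriv:
  assumes "cmod p = 1" "cmod q = 1"
  shows "((\<lambda>t. diag_action n (su2_curve p q t) \<psi> i) has_vector_derivative
     diag_action n (su2_curve p q t)
       (\<lambda>i. (q * cnj p) * raise4 n \<psi> i - cnj (q * cnj p) * lower4 n \<psi> i) i) (at t)"
proof -
  obtain a b c d where i: "i = (a, b, c, d)" by (cases i)
  let ?w = "q * cnj p"
  have "((\<lambda>t. diag_action n (su2_curve p q t) \<psi> i) has_vector_derivative
    (\<Sum>a'\<le>n. spin_rep n (su2_curve p q t) a a' *
      ((\<Sum>b'\<le>n. spin_rep n (su2_curve p q t) b b' *
        ((\<Sum>c'\<le>n. spin_rep n (su2_curve p q t) c c' *
          ((\<Sum>d'\<le>n. spin_rep n (su2_curve p q t) d d' * (0 + su2_gen n ?w (\<lambda>x. \<psi> (a', b', c', x)) d'))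
          + su2_gen n ?w (\<lambda>x. \<Sum>d'\<le>n. spin_rep n (su2_curve p q t) d d' * \<psi> (a', b', x, d')) c'))
        + su2_gen n ?w (\<lambda>x. \<Sum>c'\<le>n. spin_rep n (su2_curve p q t) c c' *
            (\<Sum>d'\<le>n. spin_rep n (su2_curve p q t) d d' * \<psi> (a', x, c', d'))) b'))
      + su2_gen n ?w (\<lambda>x. \<Sum>b'\<le>n. spin_rep n (su2_curve p q t) b b' *
          (\<Sum>c'\<le>n. spin_rep n (su2_curve p q t) c c' *
            (\<Sum>d'\<le>n. spin_rep n (su2_curve p q t) d d' * \<psi> (x, b', c', d')))) a'))) (at t)"
    unfolding i diag_action_nested
    \<comment> \<open>Four nested uses, one for each factor; the innermost \<open>G\<close> is the
      constant tensor, which explains the summand 0.\<close>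
    by (intro spin_rep_sum_deriv[OF assms] has_vector_derivative_const)
  also have "(\<Sum>a'\<le>n. spin_rep n (su2_curve p q t) a a' *
      ((\<Sum>b'\<le>n. spin_rep n (su2_curve p q t) b b' *
        ((\<Sum>c'\<le>n. spin_rep n (su2_curve p q t) c c' *
          ((\<Sum>d'\<le>n. spin_rep n (su2_curve p q t) d d' * (0 + su2_gen n ?w (\<lambda>x. \<psi> (a', b', c', x)) d'))
          + su2_gen n ?w (\<lambda>x. \<Sum>d'\<le>n. spin_rep n (su2_curve p q t) d d' * \<psi> (a', b', x, d')) c'))
        + su2_gen n ?w (\<lambda>x. \<Sum>c'\<le>n. spin_rep n (su2_curve p q t) c c' *
            (\<Sum>d'\<le>n. spin_rep n (su2_curve p q t) d d' * \<psi> (a', x, c', d'))) b'))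
      + su2_gen n ?w (\<lambda>x. \<Sum>b'\<le>n. spin_rep n (su2_curve p q t) b b' *
          (\<Sum>c'\<le>n. spin_rep n (su2_curve p q t) c c' *
            (\<Sum>d'\<le>n. spin_rep n (su2_curve p q t) d d' * \<psi> (x, b', c', d')))) a'))
    = diag_action n (su2_curve p q t)
       (\<lambda>i. ?w * raise4 n \<psi> i - cnj ?w * lower4 n \<psi> i) i"
    unfolding i diag_action_nested su2_gen4
    by (simp only: su2_gen_sum distrib_left sum.distrib add_0_left add_ac)
  finally show ?thesis .
qed

text \<open>At \<open>t = 0\<close> the curve is the diagonal matrix with entries \<open>p\<close>
  and \<open>cnj p\<close>, so the basis consists of weight vectors of the torus.\<close>

lemma spin_rep_diag:
  assumes "m \<le> n" "k \<le> n"
  shows "spin_rep n (su2_curve p q 0) m k = (if k = m then p ^ k * cnj p ^ (n - k) else 0)"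
proof -
  have "[:0, p:] ^ k * [:cnj p:] ^ (n - k) = monom (p ^ k * cnj p ^ (n - k)) k"
  proof -
    have "[:0, p:] = monom p 1" "[:cnj p:] = monom (cnj p) 0"
      by (simp_all add: monom_0 monom_Suc)
    then show ?thesis by (simp only: monom_power mult_monom) simp
  qed
  then show ?thesis by (simp add: spin_rep_def)
qed

lemma diag_action_diag:
  assumes "(a, b, c, d) \<in> idx4 n"
  shows "diag_action n (su2_curve p q 0) \<psi> (a, b, c, d)
    = p ^ (a + b + c + d) * cnj p ^ (4 * n - (a + b + c + d)) * \<psi> (a, b, c, d)"
proof -
  have e: "4 * n - (a + b + c + d) = (n - a) + (n - b) + (n - c) + (n - d)" and
    "a \<le> n" "b \<le> n" "c \<le> n" "d \<le> n" using assms by (auto simp: idx4_def)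
  moreover have "(\<Sum>k\<le>n. spin_rep n (su2_curve p q 0) m k * F k) = p ^ m * cnj p ^ (n - m) * F m"
    if "m \<le> n" for m F
  proof -
    have "(\<Sum>k\<le>n. spin_rep n (su2_curve p q 0) m k * F k)
        = (\<Sum>k\<le>n. if k = m then p ^ k * cnj p ^ (n - k) * F k else 0)"
      using that by (intro sum.cong refl) (simp add: spin_rep_diag)
    then show ?thesis using that by simp
  qed
  ultimately show ?thesis
    unfolding diag_action_nested e by (simp only:) (simp only: power_add mult_ac)
qed

lemma raise4_weight:
  assumes "\<forall>a b c d. \<psi> (a, b, c, d) \<noteq> 0 \<longrightarrow> a + b + c + d = 2 * n" "a + b + c + d \<noteq> 2 * n + 1"
  shows "raise4 n \<psi> (a, b, c, d) = 0"
proof -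
  have z: "\<psi> (a, b, c, d) = 0" if "a + b + c + d \<noteq> 2 * n" for a b c d
    using assms(1) that by blast
  show ?thesis
    using assms(2) by (auto simp: raise4_def raise2_def raise1_def z split: nat.split)
qed

lemma lower4_weight:
  assumes "\<forall>a b c d. \<psi> (a, b, c, d) \<noteq> 0 \<longrightarrow> a + b + c + d = 2 * n" "a + b + c + d + 1 \<noteq> 2 * n"
  shows "lower4 n \<psi> (a, b, c, d) = 0"
proof -
  have z: "\<psi> (a, b, c, d) = 0" if "a + b + c + d \<noteq> 2 * n" for a b c d
    using assms(1) that by blast
  show ?thesis
    using assms(2) by (simp add: lower4_def lower2_def lower1_def z)
qed

text \<open>From invariance, a single diagonal element detects the total weight, and the derivative
  of a single curve at the identity gives the ladder conditions. Conversely, the ladder conditions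
  make the action constant along every curve, and at its diagonal starting point a tensor of weight
  \<open>2 * n\<close> is fixed since the phases cancel.\<close>

lemma H_inv_iff:
  "\<psi> \<in> H_inv n \<longleftrightarrow> \<psi> \<in> tensor_space4 n \<and>
     (\<forall>a b c d. \<psi> (a, b, c, d) \<noteq> 0 \<longrightarrow> a + b + c + d = 2 * n) \<and>
     (\<forall>i\<in>idx4 n. raise4 n \<psi> i = 0 \<and> lower4 n \<psi> i = 0)" (is "?L \<longleftrightarrow> ?R")
proof
  assume L: ?L
  then have ts: "\<psi> \<in> tensor_space4 n"
    and inv: "\<And>g i. g \<in> SU2 \<Longrightarrow> i \<in> idx4 n \<Longrightarrow> diag_action n g \<psi> i = \<psi> i"
    by (auto simp: H_inv_def)
  have wt: "a + b + c + d = 2 * n" if nz: "\<psi> (a, b, c, d) \<noteq> 0" for a b c d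
  proof -
    have i: "(a, b, c, d) \<in> idx4 n" using ts nz by (auto simp: tensor_space4_def)
    define s where "s = a + b + c + d"
    have s: "s \<le> 4 * n" using i by (auto simp: s_def idx4_def)
    \<comment> \<open>The angle to be excluded is \<open>2 * s - 4 * n\<close> times
      \<open>\<theta>\<close>. With this \<open>\<theta>\<close> its modulus is below pi, so
      \<open>cis\<close> equals 1 only at angle zero.\<close>
    define \<theta> :: real where "\<theta> = 1 / (4 * real n + 1)"
    have "cis \<theta> ^ s * cnj (cis \<theta>) ^ (4 * n - s) = 1"
      using inv[OF su2_curve_in_SU2[of "cis \<theta>" 1 0] i] nz
      unfolding diag_action_diag[OF i] s_def by simp
    then have "cis (real s * \<theta> - real (4 * n - s) * \<theta>) = 1"
      unfolding cis_cnj Complex.DeMoivre cis_mult by simp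
    moreover have "real s * \<theta> - real (4 * n - s) * \<theta> = (2 * real s - 4 * real n) * \<theta>"
      using s by (simp add: of_nat_diff algebra_simps)
    ultimately have "cis ((2 * real s - 4 * real n) * \<theta>) = 1"
      by (simp only:)
    moreover have "\<bar>(2 * real s - 4 * real n) * \<theta>\<bar> \<le> pi"
    proof -
      have "\<bar>2 * real s - 4 * real n\<bar> * \<theta> \<le> (4 * real n + 1) * \<theta>"
        using s by (intro mult_right_mono) (auto simp: \<theta>_def)
      also have "\<dots> = 1" by (simp add: \<theta>_def add_nonneg_eq_0_iff)
      finally have "\<bar>2 * real s - 4 * real n\<bar> * \<theta> \<le> pi" using pi_gt3 by linarith
      moreover have "\<theta> \<ge> 0" by (simp add: \<theta>_def)
      ultimately show ?thesis by (simp only: abs_mult abs_of_nonneg)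
    qed
    ultimately have "(2 * real s - 4 * real n) * \<theta> = 0"
      using cos_inj_pi[of "\<bar>(2 * real s - 4 * real n) * \<theta>\<bar>" 0]
      by (simp add: complex_eq_iff)
    then have "2 * real s = 4 * real n" by (simp add: \<theta>_def add_nonneg_eq_0_iff)
    then have "real s = real (2 * n)" by simp
    then show ?thesis unfolding s_def by (simp only: of_nat_eq_iff)
  qed
  have "raise4 n \<psi> i = 0 \<and> lower4 n \<psi> i = 0" if i: "i \<in> idx4 n" for i
  proof -
    obtain a b c d where abcd: "i = (a, b, c, d)" by (cases i)
    \<comment> \<open>With \<open>p = q = 1\<close> the curve starts at the identity, and its
      generator is raising minus lowering.\<close>
    have "((\<lambda>t. diag_action n (su2_curve 1 1 t) \<psi> i) has_vector_derivative
       diag_action n (su2_curve 1 1 0)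
         (\<lambda>i. (1 * cnj 1) * raise4 n \<psi> i - cnj (1 * cnj 1) * lower4 n \<psi> i) i) (at 0)"
      by (rule diag_action_deriv) simp_all
    moreover have "(\<lambda>t. diag_action n (su2_curve 1 1 t) \<psi> i) = (\<lambda>t. \<psi> i)"
      by (intro ext inv su2_curve_in_SU2 i) simp_all
    ultimately have "diag_action n (su2_curve 1 1 0)
         (\<lambda>i. (1 * cnj 1) * raise4 n \<psi> i - cnj (1 * cnj 1) * lower4 n \<psi> i) i = 0"
      using vector_derivative_unique_at[OF _ has_vector_derivative_const] by (simp only:)
    then have "raise4 n \<psi> i = lower4 n \<psi> i"
      using i unfolding abcd by (subst (asm) diag_action_diag) auto
    \<comment> \<open>The raised tensor has weight \<open>2 * n + 1\<close> and the lowered one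
      \<open>2 * n - 1\<close>, so at a given index at most one of them is nonzero; being equal,
      both vanish.\<close>
    moreover have "raise4 n \<psi> i = 0 \<or> lower4 n \<psi> i = 0"
      using raise4_weight[of \<psi> n a b c d] lower4_weight[of \<psi> n a b c d] wt
      unfolding abcd by (cases "a + b + c + d = 2 * n + 1") auto
    ultimately show ?thesis by auto
  qed
  then show ?R using ts wt by blast
next
  assume R: ?R
  have "diag_action n g \<psi> i = \<psi> i" if g: "g \<in> SU2" and i: "i \<in> idx4 n" for g i
  proof -
    obtain a b c d where abcd: "i = (a, b, c, d)" by (cases i)
    from g obtain p q t where pq: "cmod p = 1" "cmod q = 1" and gt: "g = su2_curve p q t"
      by (rule SU2_on_curve)
    have "((\<lambda>t. diag_action n (su2_curve p q t) \<psi> i) has_vector_derivative 0) (at t within UNIV)" for t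
    proof -
      have "diag_action n (su2_curve p q t)
         (\<lambda>i. (q * cnj p) * raise4 n \<psi> i - cnj (q * cnj p) * lower4 n \<psi> i) i = 0"
        using R unfolding abcd diag_action_def by (auto intro!: sum.neutral)
      then show ?thesis using diag_action_deriv[OF pq, of n \<psi> i t] by simp
    qed
    then have "diag_action n (su2_curve p q t) \<psi> i = diag_action n (su2_curve p q 0) \<psi> i"
      by (rule has_vector_derivative_zero_constant[OF convex_UNIV]) simp_all
    also have "\<dots> = \<psi> i"
    proof (cases "\<psi> i = 0")
      case True
      then show ?thesis using i unfolding abcd by (simp add: diag_action_diag)
    next
      case False
      then have "a + b + c + d = 2 * n" using R unfolding abcd by blast
      then show ?thesis using i unfolding abcd
        by (simp add: diag_action_diag unit_complex[OF pq(1)] flip: power_mult_distrib)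
    qed
    finally show ?thesis unfolding gt .
  qed
  then show ?L using R by (simp add: H_inv_def)
qed

section \<open>Moments of a Haar-random unit vector\<close>

text \<open>Row and column relations are both recorded, so that the conjugate transpose is available
  as a two-sided inverse without a dimension argument.\<close>

definition unitary_matrix :: "nat \<Rightarrow> (nat \<Rightarrow> nat \<Rightarrow> complex) \<Rightarrow> bool" where
  "unitary_matrix n W \<longleftrightarrow> (\<forall>J\<le>n. \<forall>K\<le>n.
     (\<Sum>L\<le>n. W J L * cnj (W K L)) = (if J = K then 1 else 0) \<and>
     (\<Sum>L\<le>n. cnj (W L J) * W L K) = (if J = K then 1 else 0))"

definition phase_matrix :: "nat \<Rightarrow> complex \<Rightarrow> nat \<Rightarrow> nat \<Rightarrow> complex" where
  "phase_matrix J z A B = (if A = B then if A = J then z else 1 else 0)"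

lemma phase_matrix_sum:
  assumes "A \<le> n"
  shows "(\<Sum>B\<le>n. phase_matrix J z A B * f B) = (if A = J then z else 1) * f A"
proof -
  have "(\<Sum>B\<le>n. phase_matrix J z A B * f B) = (\<Sum>B\<le>n. if B = A then (if A = J then z else 1) * f B else 0)"
    by (rule sum.cong) (auto simp: phase_matrix_def)
  then show ?thesis using assms by simp
qed

lemma phase_matrix_unitary:
  assumes "cmod z = 1"
  shows "unitary_matrix n (phase_matrix J z)"
proof -
  have z: "z * cnj z = 1" using assms by (simp add: complex_norm_square[symmetric])
  have s: "phase_matrix J z A B = phase_matrix J z B A" for A B by (auto simp: phase_matrix_def)
  have 1: "(\<Sum>L\<le>n. phase_matrix J z A L * cnj (phase_matrix J z B L)) = (if A = B then 1 else 0)"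
    if "A \<le> n" for A B
    using z that by (subst phase_matrix_sum) (auto simp: phase_matrix_def)
  have 2: "(\<Sum>L\<le>n. cnj (phase_matrix J z L A) * phase_matrix J z L B) = (if A = B then 1 else 0)"
    if "B \<le> n" for A B
    using 1[OF that, of A] by (simp add: s[of _ A] s[of _ B] mult.commute eq_commute)
  show ?thesis unfolding unitary_matrix_def using 1 2 by blast
qed

definition rotation_matrix :: "nat \<Rightarrow> nat \<Rightarrow> real \<Rightarrow> real \<Rightarrow> nat \<Rightarrow> nat \<Rightarrow> complex" where
  "rotation_matrix J K u v A B =
     (if A = J then if B = J then u else if B = K then v else 0
      else if A = K then if B = J then - v else if B = K then u else 0
      else if A = B then 1 else 0)"

lemma sum_split_pair:
  fixes f :: "nat \<Rightarrow> complex"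
  assumes "J \<noteq> K" "J \<le> n" "K \<le> n"
  shows "(\<Sum>L\<le>n. f L) = f J + f K + (\<Sum>L\<in>{..n} - {J, K}. f L)"
proof -
  have "(\<Sum>L\<le>n. f L) = (\<Sum>L\<in>{J, K}. f L) + (\<Sum>L\<in>{..n} - {J, K}. f L)"
    using assms by (subst sum.subset_diff[of "{J, K}"]) (auto simp: add.commute)
  then show ?thesis using assms by simp
qed

lemma rotation_matrix_sum:
  assumes "J \<noteq> K" "J \<le> n" "K \<le> n"
  shows "(\<Sum>B\<le>n. rotation_matrix J K u v J B * f B) = u * f J + v * f K"
  using assms by (subst sum_split_pair[OF assms]) (simp add: rotation_matrix_def)

lemma rotation_matrix_unitary:
  assumes JK: "J \<noteq> K" "J \<le> n" "K \<le> n" and uv: "u\<^sup>2 + v\<^sup>2 = 1"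
  shows "unitary_matrix n (rotation_matrix J K u v)"
proof -
  have 1: "(\<Sum>L\<le>n. rotation_matrix J K u v A L * cnj (rotation_matrix J K u v B L))
      = (if A = B then 1 else 0)" if u: "u\<^sup>2 + v\<^sup>2 = 1" "A \<le> n" "B \<le> n" for u v A B
  proof -
    have c: "complex_of_real u * complex_of_real u + complex_of_real v * complex_of_real v = 1"
      unfolding of_real_mult[symmetric] of_real_add[symmetric] using u by (simp add: power2_eq_square)
    have c': "complex_of_real v * complex_of_real v + complex_of_real u * complex_of_real u = 1"
      using c by (simp add: add.commute)
    show ?thesis
    proof (cases "A \<in> {J, K}")
      case True
      then have "(\<Sum>L\<in>{..n} - {J, K}. rotation_matrix J K u v A L * cnj (rotation_matrix J K u v B L)) = 0"
        by (intro sum.neutral) (auto simp: rotation_matrix_def)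
      then show ?thesis using True JK c c'
        by (subst sum_split_pair[OF JK]) (auto simp: rotation_matrix_def)
    next
      case False
      then have "(\<Sum>L\<le>n. rotation_matrix J K u v A L * cnj (rotation_matrix J K u v B L))
          = (\<Sum>L\<le>n. if L = A then cnj (rotation_matrix J K u v B L) else 0)"
        by (intro sum.cong) (auto simp: rotation_matrix_def)
      then show ?thesis using False that by (auto simp: rotation_matrix_def)
    qed
  qed
  \<comment> \<open>Transposing a rotation flips the sign of \<open>v\<close>, so the column
    relations are the row relations for \<open>- v\<close>.\<close>
  have s: "cnj (rotation_matrix J K u v L A) = rotation_matrix J K u (- v) A L"
     "rotation_matrix J K u v L B = cnj (rotation_matrix J K u (- v) B L)" for L A B
    using JK by (auto simp: rotation_matrix_def)
  have 2: "(\<Sum>L\<le>n. cnj (rotation_matrix J K u v L A) * rotation_matrix J K u v L B)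
      = (if A = B then 1 else 0)" if "A \<le> n" "B \<le> n" for A B
  proof -
    have "(\<Sum>L\<le>n. cnj (rotation_matrix J K u v L A) * rotation_matrix J K u v L B)
        = (\<Sum>L\<le>n. rotation_matrix J K u (- v) A L * cnj (rotation_matrix J K u (- v) B L))"
      by (intro sum.cong refl arg_cong2[of _ _ _ _ "(*)"] s)
    then show ?thesis using uv that by (subst (asm) 1) auto
  qed
  show ?thesis unfolding unitary_matrix_def using 1[OF uv] 2 by blast
qed

lemma polynomial_zero_on_nonneg:
  fixes c :: "nat \<Rightarrow> real"
  assumes "\<And>s. s \<ge> 0 \<Longrightarrow> (\<Sum>i\<le>k. c i * s ^ i) = 0" "i \<le> k"
  shows "c i = 0"
proof -
  define p where "p = (\<Sum>i\<le>k. monom (c i) i)"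
  have "{0..} \<subseteq> {s. poly p s = 0}"
    using assms(1) by (auto simp: p_def poly_sum poly_monom)
  moreover have "infinite {0::real..}" by (rule infinite_Ici)
  ultimately have "p = 0" using poly_roots_finite finite_subset by blast
  then have "coeff p i = 0" by simp
  then show ?thesis using assms(2) by (simp add: p_def coeff_sum)
qed

text \<open>A random unit vector in complex dimension \<open>n + 1\<close> whose law is unitarily
  invariant. The test function \<open>g\<close> may depend only on the coordinates up to
  \<open>n\<close>, because the rows of \<open>W\<close> beyond \<open>n\<close> are
  arbitrary.\<close>

locale haar_vector = prob_space M for M :: "'a measure" +
  fixes n :: nat and \<alpha> :: "nat \<Rightarrow> 'a \<Rightarrow> complex"
  assumes measurable_\<alpha> [measurable]: "\<And>J. \<alpha> J \<in> borel_measurable M"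
    and unit: "\<And>x. x \<in> space M \<Longrightarrow> (\<Sum>J\<le>n. (cmod (\<alpha> J x))\<^sup>2) = 1"
    and invariant: "\<And>W (g :: (nat \<Rightarrow> complex) \<Rightarrow> complex). unitary_matrix n W \<Longrightarrow>
      (\<And>u v. (\<And>J. J \<le> n \<Longrightarrow> u J = v J) \<Longrightarrow> g u = g v) \<Longrightarrow>
      (\<lambda>x. g (\<lambda>J. \<alpha> J x)) \<in> borel_measurable M \<Longrightarrow>
      (\<integral>x. g (\<lambda>J. \<Sum>K\<le>n. W J K * \<alpha> K x) \<partial>M) = (\<integral>x. g (\<lambda>J. \<alpha> J x) \<partial>M)"
begin

definition wt :: "nat \<Rightarrow> 'a \<Rightarrow> real" where
  "wt J x = (cmod (\<alpha> J x))\<^sup>2"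

lemma measurable_cnj_\<alpha> [measurable]: "(\<lambda>x. cnj (\<alpha> J x)) \<in> borel_measurable M"
  by (rule measurable_compose[OF measurable_\<alpha>])
    (intro borel_measurable_continuous_onI continuous_intros)

lemma measurable_wt [measurable]: "wt J \<in> borel_measurable M"
  unfolding wt_def by measurable

lemma wt_nonneg [simp]: "wt J x \<ge> 0"
  by (simp add: wt_def)

lemma wt_le_1:
  assumes "J \<le> n" "x \<in> space M"
  shows "wt J x \<le> 1"
proof -
  have "(cmod (\<alpha> J x))\<^sup>2 \<le> (\<Sum>J\<le>n. (cmod (\<alpha> J x))\<^sup>2)"
    by (rule member_le_sum) (use assms in auto)
  then show ?thesis using unit[OF assms(2)] by (simp add: wt_def)
qed

lemma cmod_\<alpha>_le_1: "J \<le> n \<Longrightarrow> x \<in> space M \<Longrightarrow> cmod (\<alpha> J x) \<le> 1"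
  using wt_le_1[of J x] by (simp add: wt_def power_le_one_iff)

lemma wt_complex: "complex_of_real (wt J x) = \<alpha> J x * cnj (\<alpha> J x)"
  unfolding wt_def by (rule complex_norm_square)

lemma integrable_monomial:
  assumes "J \<le> n" "K \<le> n"
  shows "integrable M (\<lambda>x. \<alpha> J x ^ a * cnj (\<alpha> J x) ^ b * (\<alpha> K x ^ c * cnj (\<alpha> K x) ^ d))"
proof (rule integrable_const_bound[of _ 1])
  show "AE x in M. cmod (\<alpha> J x ^ a * cnj (\<alpha> J x) ^ b * (\<alpha> K x ^ c * cnj (\<alpha> K x) ^ d)) \<le> 1"
  proof (rule AE_I2)
    fix x assume x: "x \<in> space M"
    have "cmod (\<alpha> J x) ^ a \<le> 1" "cmod (\<alpha> J x) ^ b \<le> 1" "cmod (\<alpha> K x) ^ c \<le> 1" "cmod (\<alpha> K x) ^ d \<le> 1"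
      using cmod_\<alpha>_le_1[OF assms(1) x] cmod_\<alpha>_le_1[OF assms(2) x] by (auto intro: power_le_one)
    then show "cmod (\<alpha> J x ^ a * cnj (\<alpha> J x) ^ b * (\<alpha> K x ^ c * cnj (\<alpha> K x) ^ d)) \<le> 1"
      by (simp add: norm_mult norm_power mult_le_one)
  qed
qed measurable

lemma integrable_wt_monomial:
  assumes "J \<le> n" "K \<le> n"
  shows "integrable M (\<lambda>x. wt J x ^ a * wt K x ^ b)"
proof (rule integrable_const_bound[of _ 1])
  show "AE x in M. norm (wt J x ^ a * wt K x ^ b) \<le> 1"
  proof (rule AE_I2)
    fix x assume x: "x \<in> space M"
    have "wt J x ^ a \<le> 1" "wt K x ^ b \<le> 1"
      using wt_le_1[OF assms(1) x] wt_le_1[OF assms(2) x] by (auto intro: power_le_one)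
    then show "norm (wt J x ^ a * wt K x ^ b) \<le> 1"
      by (simp add: abs_mult mult_le_one)
  qed
qed measurable

lemma integral_unbalanced:
  assumes "J \<noteq> K" "J \<le> n" "K \<le> n" "a \<noteq> b"
  shows "(\<integral>x. \<alpha> J x ^ a * cnj (\<alpha> J x) ^ b * (\<alpha> K x ^ c * cnj (\<alpha> K x) ^ d) \<partial>M) = 0"
    (is "?I = 0")
proof -
  \<comment> \<open>Chosen so that the net phase, with exponent \<open>a - b\<close>, equals -1; the
    integral is then its own negative.\<close>
  define \<theta> where "\<theta> = pi / (real a - real b)"
  have "cis \<theta> ^ a * cnj (cis \<theta>) ^ b = cis (real a * \<theta> + real b * - \<theta>)"
    by (simp only: cis_cnj Complex.DeMoivre cis_mult)
  also have "real a * \<theta> + real b * - \<theta> = pi"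
  proof -
    have "real a * \<theta> + real b * - \<theta> = (real a - real b) * \<theta>"
      by (simp add: left_diff_distrib)
    then show ?thesis using assms(4) by (simp add: \<theta>_def)
  qed
  finally have z: "cis \<theta> ^ a * cnj (cis \<theta>) ^ b = - 1" by simp
  define g :: "(nat \<Rightarrow> complex) \<Rightarrow> complex"
    where "g = (\<lambda>u. u J ^ a * cnj (u J) ^ b * (u K ^ c * cnj (u K) ^ d))"
  have "(\<integral>x. g (\<lambda>A. \<Sum>B\<le>n. phase_matrix J (cis \<theta>) A B * \<alpha> B x) \<partial>M) = (\<integral>x. g (\<lambda>A. \<alpha> A x) \<partial>M)"
    by (rule invariant) (use assms in \<open>auto simp: g_def phase_matrix_unitary\<close>)
  also have "(\<lambda>x. g (\<lambda>A. \<Sum>B\<le>n. phase_matrix J (cis \<theta>) A B * \<alpha> B x)) = (\<lambda>x. - g (\<lambda>A. \<alpha> A x))"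
  proof
    fix x
    have "g (\<lambda>A. \<Sum>B\<le>n. phase_matrix J (cis \<theta>) A B * \<alpha> B x)
        = (cis \<theta> ^ a * cnj (cis \<theta>) ^ b) * g (\<lambda>A. \<alpha> A x)"
      unfolding g_def phase_matrix_sum[OF assms(2)] phase_matrix_sum[OF assms(3)]
      using assms(1) by (simp add: power_mult_distrib mult_ac)
    then show "g (\<lambda>A. \<Sum>B\<le>n. phase_matrix J (cis \<theta>) A B * \<alpha> B x) = - g (\<lambda>A. \<alpha> A x)"
      unfolding z by simp
  qed
  finally have "- (\<integral>x. g (\<lambda>A. \<alpha> A x) \<partial>M) = (\<integral>x. g (\<lambda>A. \<alpha> A x) \<partial>M)" by simp
  then have "(\<integral>x. g (\<lambda>A. \<alpha> A x) \<partial>M) = 0" by simp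
  then show ?thesis by (simp add: g_def)
qed

lemma integral_balanced:
  "(\<integral>x. \<alpha> J x ^ a * cnj (\<alpha> J x) ^ a * (\<alpha> K x ^ c * cnj (\<alpha> K x) ^ c) \<partial>M)
    = complex_of_real (\<integral>x. wt J x ^ a * wt K x ^ c \<partial>M)"
  by (simp add: wt_complex power_mult_distrib flip: integral_complex_of_real)

text \<open>By unitary invariance \<open>\<bar>u \<alpha>\<^sub>J + v \<alpha>\<^sub>K\<bar>^(2 k)\<close> has the same mean for all
  \<open>u\<^sup>2 + v\<^sup>2 = 1\<close>; the phase averages kill the unbalanced terms of its expansion, and comparing
  coefficients in \<open>s = u\<^sup>2 / v\<^sup>2\<close> determines the remaining ones.\<close>

lemma pair_moment:
  assumes JK: "J \<noteq> K" "J \<le> n" "K \<le> n" and "i \<le> k"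
  shows "real (k choose i) * (\<integral>x. wt J x ^ i * wt K x ^ (k - i) \<partial>M) = (\<integral>x. wt J x ^ k \<partial>M)"
proof -
  define m where "m = (\<lambda>i. \<integral>x. wt J x ^ i * wt K x ^ (k - i) \<partial>M)"
  define P where "P = (\<integral>x. wt J x ^ k \<partial>M)"
  have sum: "(\<Sum>i\<le>k. (real (k choose i))\<^sup>2 * s ^ i * m i) = (1 + s) ^ k * P" if "s \<ge> 0" for s
  proof -
    define u v where "u = sqrt (s / (1 + s))" and "v = sqrt (1 / (1 + s))"
    have u2: "u\<^sup>2 = s / (1 + s)" and v2: "v\<^sup>2 = 1 / (1 + s)"
      using that by (simp_all add: u_def v_def)
    have uv: "u\<^sup>2 + v\<^sup>2 = 1"
      unfolding u2 v2 using that by (simp add: field_simps)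
    define g :: "(nat \<Rightarrow> complex) \<Rightarrow> complex" where "g = (\<lambda>y. y J ^ k * cnj (y J) ^ k)"
    define C where "C = (\<lambda>i l. of_nat (k choose i) * of_nat (k choose l)
       * complex_of_real (u ^ i * v ^ (k - i) * (u ^ l * v ^ (k - l))))"
    define f where "f = (\<lambda>i l x. \<alpha> J x ^ i * cnj (\<alpha> J x) ^ l * (\<alpha> K x ^ (k - i) * cnj (\<alpha> K x) ^ (k - l)))"
    have int: "integrable M (f i l)" for i l
      unfolding f_def by (rule integrable_monomial[OF JK(2,3)])
    have "g (\<lambda>A. \<Sum>B\<le>n. rotation_matrix J K u v A B * \<alpha> B x) = (\<Sum>i\<le>k. \<Sum>l\<le>k. C i l * f i l x)" for x
    proof -
      have "g (\<lambda>A. \<Sum>B\<le>n. rotation_matrix J K u v A B * \<alpha> B x)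
          = (u * \<alpha> J x + v * \<alpha> K x) ^ k * (u * cnj (\<alpha> J x) + v * cnj (\<alpha> K x)) ^ k"
        unfolding g_def rotation_matrix_sum[OF JK] by simp
      also have "\<dots> = (\<Sum>i\<le>k. \<Sum>l\<le>k. C i l * f i l x)"
        unfolding binomial_ring sum_product C_def f_def
        by (intro sum.cong refl) (simp add: power_mult_distrib mult_ac)
      finally show ?thesis .
    qed
    then have "(\<integral>x. g (\<lambda>A. \<Sum>B\<le>n. rotation_matrix J K u v A B * \<alpha> B x) \<partial>M)
        = (\<Sum>i\<le>k. \<Sum>l\<le>k. C i l * (\<integral>x. f i l x \<partial>M))"
      using int by simp
    also have "\<dots> = (\<Sum>i\<le>k. \<Sum>l\<le>k. if l = i then C i i * complex_of_real (m i) else 0)"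
      by (intro sum.cong refl)
        (auto simp: f_def m_def integral_balanced integral_unbalanced[OF JK])
    also have "\<dots> = (\<Sum>i\<le>k. C i i * complex_of_real (m i))" by simp
    finally have lhs: "(\<integral>x. g (\<lambda>A. \<Sum>B\<le>n. rotation_matrix J K u v A B * \<alpha> B x) \<partial>M)
        = complex_of_real (\<Sum>i\<le>k. (real (k choose i))\<^sup>2 * (u ^ i * v ^ (k - i))\<^sup>2 * m i)"
      by (simp add: C_def power2_eq_square)
    have "(\<integral>x. g (\<lambda>A. \<Sum>B\<le>n. rotation_matrix J K u v A B * \<alpha> B x) \<partial>M) = (\<integral>x. g (\<lambda>A. \<alpha> A x) \<partial>M)"
      by (rule invariant[OF rotation_matrix_unitary[OF JK uv]]) (use JK in \<open>auto simp: g_def\<close>)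
    also have "\<dots> = complex_of_real P"
      using integral_balanced[of J k J 0] by (simp add: g_def P_def)
    finally have eq: "(\<Sum>i\<le>k. (real (k choose i))\<^sup>2 * (u ^ i * v ^ (k - i))\<^sup>2 * m i) = P"
      unfolding lhs of_real_eq_iff .
    have uvi: "(1 + s) ^ k * (u ^ i * v ^ (k - i))\<^sup>2 = s ^ i" if "i \<le> k" for i
    proof -
      have "(u ^ i * v ^ (k - i))\<^sup>2 = (u\<^sup>2) ^ i * (v\<^sup>2) ^ (k - i)"
        by (simp add: power_mult_distrib power_mult[symmetric] mult.commute)
      also have "\<dots> = s ^ i / ((1 + s) ^ i * (1 + s) ^ (k - i))"
        unfolding u2 v2 by (simp add: power_divide)
      also have "(1 + s) ^ i * (1 + s) ^ (k - i) = (1 + s) ^ k"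
        using that by (simp flip: power_add)
      finally show ?thesis using \<open>s \<ge> 0\<close> by simp
    qed
    have "(1 + s) ^ k * P = (\<Sum>i\<le>k. (real (k choose i))\<^sup>2 * ((1 + s) ^ k * (u ^ i * v ^ (k - i))\<^sup>2) * m i)"
      unfolding eq[symmetric] sum_distrib_left by (simp add: mult_ac)
    also have "\<dots> = (\<Sum>i\<le>k. (real (k choose i))\<^sup>2 * s ^ i * m i)"
      by (intro sum.cong refl) (simp add: uvi)
    finally show ?thesis by simp
  qed
  \<comment> \<open>Expanding \<open>(1 + s) ^ k\<close> as well gives every coefficient a nonzero
    binomial factor, which can be cancelled once the coefficient is known to vanish.\<close>
  have "(\<Sum>i\<le>k. (real (k choose i) * (real (k choose i) * m i - P)) * s ^ i) = 0" if "s \<ge> 0" for s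
  proof -
    have "(1 + s) ^ k * P = (\<Sum>i\<le>k. real (k choose i) * s ^ i * P)"
      unfolding add.commute[of 1 s] binomial_ring by (simp add: sum_distrib_right)
    then show ?thesis
      using sum[OF that] by (simp add: algebra_simps sum_subtractf power2_eq_square)
  qed
  from polynomial_zero_on_nonneg[OF this \<open>i \<le> k\<close>] \<open>i \<le> k\<close> show ?thesis
    by (simp add: m_def P_def)
qed

definition mom :: "nat \<Rightarrow> real" where
  "mom k = (\<integral>x. wt 0 x ^ k \<partial>M)"

text \<open>The extreme case \<open>i = 0\<close> of \<open>pair_moment\<close> exchanges the two
  coordinates.\<close>

lemma integral_wt_power: "J \<le> n \<Longrightarrow> (\<integral>x. wt J x ^ k \<partial>M) = mom k"
  using pair_moment[of J 0 0 k] by (cases "J = 0") (auto simp: mom_def)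

lemma integral_wt_pair:
  assumes "J \<noteq> K" "J \<le> n" "K \<le> n"
  shows "(\<integral>x. wt J x ^ a * wt K x ^ b \<partial>M) = mom (a + b) / real (a + b choose a)"
  using pair_moment[OF assms, of a "a + b"] integral_wt_power[OF assms(2), of "a + b"]
  by (simp add: field_simps)

text \<open>The factor 1 is inserted as the sum of all weights: one term is the next moment, and
  each of the other \<open>n\<close> terms is that moment divided by \<open>k + 1\<close>. Iterated
  from \<open>mom 0 = 1\<close>, this gives the reciprocal of the binomial coefficient of
  \<open>n + k\<close> over \<open>k\<close>.\<close>

lemma mom_rec: "mom k = mom (Suc k) * (real n + 1 + real k) / (real k + 1)"
proof -
  have "mom k = (\<integral>x. (\<Sum>K\<le>n. wt 0 x ^ k * wt K x ^ 1) \<partial>M)"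
    unfolding mom_def
    by (rule Bochner_Integration.integral_cong)
      (use unit in \<open>simp_all add: wt_def flip: sum_distrib_left\<close>)
  also have "\<dots> = (\<Sum>K\<le>n. \<integral>x. wt 0 x ^ k * wt K x ^ 1 \<partial>M)"
    by (rule Bochner_Integration.integral_sum) (use integrable_wt_monomial[of 0 _ k 1] in auto)
  also have "\<dots> = (\<Sum>K\<in>{..n} - {0}. \<integral>x. wt 0 x ^ k * wt K x ^ 1 \<partial>M) + mom (Suc k)"
    by (subst sum.remove[of _ 0]) (simp_all add: mom_def mult.commute)
  also have "(\<Sum>K\<in>{..n} - {0}. \<integral>x. wt 0 x ^ k * wt K x ^ 1 \<partial>M) = (\<Sum>K\<in>{..n} - {0}. mom (Suc k) / (real k + 1))"
    by (intro sum.cong refl, subst integral_wt_pair) (auto simp: add.commute)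
  finally show ?thesis by (simp add: field_simps)
qed

lemma mom_0: "mom 0 = 1"
  by (simp add: mom_def prob_space)

lemma mom_2: "mom 2 = 2 / ((real n + 1) * (real n + 2))"
proof -
  have "mom 1 = 1 / (real n + 1)" "mom 1 = mom 2 * (real n + 2) / 2"
    using mom_rec[of 0] mom_rec[of 1] mom_0 by (simp_all add: field_simps eval_nat_numeral)
  then have "mom 2 * (real n + 2) = 2 / (real n + 1)"
    by simp
  then have "mom 2 = 2 / (real n + 1) / (real n + 2)"
    by (simp add: eq_divide_eq mult_ac)
  then show ?thesis by (simp only: divide_divide_eq_left)
qed

lemma mom_4: "mom 4 = 24 / ((real n + 1) * (real n + 2) * (real n + 3) * (real n + 4))"
proof -
  have "mom 2 = mom 3 * (real n + 3) / 3" "mom 3 = mom 4 * (real n + 4) / 4"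
    using mom_rec[of 2] mom_rec[of 3] by (simp_all add: eval_nat_numeral)
  then have "24 * mom 2 = 2 * (mom 4 * ((real n + 3) * (real n + 4)))"
    by (simp add: field_simps)
  then show ?thesis unfolding mom_2 by (simp add: divide_simps) (simp add: algebra_simps)
qed

section \<open>Mean and variance of the purity, for arbitrary positive weights\<close>

context
  fixes w :: "nat \<Rightarrow> real" and \<Lambda> \<Lambda>2 :: real and X :: "'a \<Rightarrow> real"
  assumes w: "\<And>J. w J > 0"
  defines "\<Lambda> \<equiv> \<Sum>J\<le>n. w J" and "\<Lambda>2 \<equiv> \<Sum>J\<le>n. (w J)\<^sup>2"
    and "X \<equiv> \<lambda>x. \<Sum>J\<le>n. w J * (wt J x)\<^sup>2"
begin

lemma integrable_wt_square: "J \<le> n \<Longrightarrow> integrable M (\<lambda>x. (wt J x)\<^sup>2)"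
  using integrable_wt_monomial[of J J 2 0] by simp

lemma expectation_purity: "expectation X = mom 2 * \<Lambda>"
  unfolding X_def \<Lambda>_def
  by (simp add: integrable_wt_square integral_wt_power sum_distrib_right mult.commute)

lemma purity_square: "(X x)\<^sup>2 = (\<Sum>J\<le>n. \<Sum>K\<le>n. w J * w K * (wt J x ^ 2 * wt K x ^ 2))"
  unfolding X_def power2_eq_square[of "sum _ _"] sum_product by (simp add: mult_ac)

lemma integrable_purity_square: "integrable M (\<lambda>x. (X x)\<^sup>2)"
  unfolding purity_square
  by (intro Bochner_Integration.integrable_sum integrable_mult_right integrable_wt_monomial) auto

text \<open>Since 4 over 2 is 6, a mixed moment is \<open>mom 4 / 6\<close>, while a diagonal one is
  six times as large; the excess of five over the mixed value produces the term with
  \<open>\<Lambda>2\<close>.\<close>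

lemma expectation_purity_square: "expectation (\<lambda>x. (X x)\<^sup>2) = mom 4 / 6 * (\<Lambda>\<^sup>2 + 5 * \<Lambda>2)"
proof -
  have "expectation (\<lambda>x. (X x)\<^sup>2) = (\<Sum>J\<le>n. \<Sum>K\<le>n. w J * w K * (\<integral>x. wt J x ^ 2 * wt K x ^ 2 \<partial>M))"
    unfolding purity_square
    by (subst Bochner_Integration.integral_sum, intro Bochner_Integration.integrable_sum
          integrable_mult_right integrable_wt_monomial, simp, simp,
        intro sum.cong refl, subst Bochner_Integration.integral_sum)
      (auto intro!: integrable_mult_right integrable_wt_monomial)
  also have "\<dots> = (\<Sum>J\<le>n. \<Sum>K\<le>n. mom 4 / 6 * (w J * w K + (if K = J then 5 * (w J)\<^sup>2 else 0)))"
  proof (intro sum.cong refl)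
    fix J K assume JK: "J \<in> {..n}" "K \<in> {..n}"
    have "(\<integral>x. wt J x ^ 2 * wt K x ^ 2 \<partial>M) = (if K = J then mom 4 else mom 4 / 6)"
    proof (cases "K = J")
      case True
      then show ?thesis using JK integral_wt_power[of J 4] by (simp flip: power_add)
    next
      case False
      have "(4 :: nat) choose 2 = 6" by (simp add: eval_nat_numeral)
      then show ?thesis using False JK integral_wt_pair[of J K 2 2] by auto
    qed
    then show "w J * w K * (\<integral>x. wt J x ^ 2 * wt K x ^ 2 \<partial>M)
        = mom 4 / 6 * (w J * w K + (if K = J then 5 * (w J)\<^sup>2 else 0))"
      by (simp add: power2_eq_square)
  qed
  also have "\<dots> = mom 4 / 6 * ((\<Sum>J\<le>n. \<Sum>K\<le>n. w J * w K)
      + (\<Sum>J\<le>n. \<Sum>K\<le>n. if K = J then 5 * (w J)\<^sup>2 else 0))"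
    by (simp only: sum_distrib_left sum.distrib distrib_left)
  also have "(\<Sum>J\<le>n. \<Sum>K\<le>n. w J * w K) = \<Lambda>\<^sup>2"
    by (simp add: \<Lambda>_def power2_eq_square sum_product)
  also have "(\<Sum>J\<le>n. \<Sum>K\<le>n. if K = J then 5 * (w J)\<^sup>2 else 0) = 5 * \<Lambda>2"
    by (simp add: \<Lambda>2_def sum_distrib_left)
  finally show ?thesis .
qed

text \<open>Distinct squared weights are not positively correlated: \<open>mom 4 / 6\<close> is at
  most \<open>(mom 2)^2\<close>. The terms in \<open>\<Lambda>^2\<close> therefore cancel in the
  bound, and only the diagonal excess survives.\<close>

lemma purity_variance: "variance X \<le> 5 * \<Lambda>2 * (mom 2)\<^sup>2"
proof -
  have X: "integrable M X"
    unfolding X_def by (auto intro!: Bochner_Integration.integrable_sum integrable_wt_square)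
  have "mom 4 / 6 \<le> (mom 2)\<^sup>2"
  proof -
    have "(real n + 1) * (real n + 2) * ((real n + 1) * (real n + 2))
        \<le> (real n + 1) * (real n + 2) * ((real n + 3) * (real n + 4))"
      by (intro mult_mono) auto
    then have "4 / ((real n + 1) * (real n + 2) * ((real n + 3) * (real n + 4)))
        \<le> 4 / ((real n + 1) * (real n + 2) * ((real n + 1) * (real n + 2)))"
      by (intro divide_left_mono) auto
    moreover have "24 / D / 6 = 4 / D" for D :: real by simp
    ultimately show ?thesis by (simp only: mom_2 mom_4 power2_eq_square mult.assoc times_divide_times_eq)
  qed
  then have "mom 4 / 6 * (\<Lambda>\<^sup>2 + 5 * \<Lambda>2) \<le> (mom 2)\<^sup>2 * (\<Lambda>\<^sup>2 + 5 * \<Lambda>2)"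
    by (intro mult_right_mono) (auto simp: \<Lambda>2_def intro!: add_nonneg_nonneg sum_nonneg)
  then show ?thesis
    unfolding variance_eq[OF X integrable_purity_square]
    unfolding expectation_purity expectation_purity_square
    by (simp add: algebra_simps)
qed

lemma purity_concentration:
  assumes "\<epsilon> > 0"
  shows "prob {x \<in> space M. \<epsilon> * (mom 2 * \<Lambda>) \<le> \<bar>X x - mom 2 * \<Lambda>\<bar>} \<le> 5 * \<Lambda>2 / (\<epsilon>\<^sup>2 * \<Lambda>\<^sup>2)"
proof -
  have m2: "mom 2 > 0" unfolding mom_2 by simp
  have L: "\<Lambda> > 0" unfolding \<Lambda>_def using w by (intro sum_pos) auto
  have "prob {x \<in> space M. \<epsilon> * (mom 2 * \<Lambda>) \<le> \<bar>X x - expectation X\<bar>}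
      \<le> variance X / (\<epsilon> * (mom 2 * \<Lambda>))\<^sup>2"
    by (intro Chebyshev_inequality integrable_purity_square) (use m2 L assms in \<open>auto simp: X_def\<close>)
  also have "\<dots> \<le> 5 * \<Lambda>2 * (mom 2)\<^sup>2 / (\<epsilon> * (mom 2 * \<Lambda>))\<^sup>2"
    by (intro divide_right_mono purity_variance) auto
  also have "\<dots> = 5 * \<Lambda>2 / (\<epsilon>\<^sup>2 * \<Lambda>\<^sup>2)"
    using m2 by (simp add: power_mult_distrib)
  finally show ?thesis unfolding expectation_purity .
qed

end

end

section \<open>The invariant tensors\<close>

lemma raise1_sum: "raise1 n (\<lambda>x. \<Sum>s\<in>S. f s x) a = (\<Sum>s\<in>S. raise1 n (f s) a)"
  by (simp add: raise1_def sum_distrib_left split: nat.split)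

lemma lower1_sum: "lower1 n (\<lambda>x. \<Sum>s\<in>S. f s x) a = (\<Sum>s\<in>S. lower1 n (f s) a)"
  by (simp add: lower1_def sum_distrib_left)

lemma raise2_sum: "raise2 n (\<lambda>a b. \<Sum>s\<in>S. f s a b) a b = (\<Sum>s\<in>S. raise2 n (f s) a b)"
  by (simp add: raise2_def raise1_sum sum.distrib)

lemma lower2_sum: "lower2 n (\<lambda>a b. \<Sum>s\<in>S. f s a b) a b = (\<Sum>s\<in>S. lower2 n (f s) a b)"
  by (simp add: lower2_def lower1_sum sum.distrib)

definition grid :: "nat \<Rightarrow> (nat \<times> nat) set" where
  "grid n = {..n} \<times> {..n}"

lemma finite_grid [simp]: "finite (grid n)"
  by (simp add: grid_def)

lemma pair2_grid: "pair2 n f g = (\<Sum>(a, b)\<in>grid n. f a b * g a b)"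
  by (simp add: pair2_def grid_def sum.cartesian_product)

lemma sum_idx4: "(\<Sum>i\<in>idx4 n. f i) = (\<Sum>(a, b)\<in>grid n. \<Sum>(c, d)\<in>grid n. f (a, b, c, d))"
  unfolding idx4_def grid_def
  by (simp add: sum.cartesian_product' case_prod_unfold)

definition cgv :: "nat \<Rightarrow> nat \<times> nat \<Rightarrow> nat \<times> nat \<Rightarrow> complex" where
  "cgv n = (\<lambda>(J, k) (a, b). cg n J k a b)"

text \<open>Passing to the opposite magnetic number within the same spin, as needed for total weight
  zero.\<close>

definition dual_idx :: "nat \<times> nat \<Rightarrow> nat \<times> nat" where
  "dual_idx = (\<lambda>(J, k). (J, 2 * J - k))"

lemma dual_idx_in: "s \<in> cgidx n \<Longrightarrow> dual_idx s \<in> cgidx n"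
  by (auto simp: cgidx_def dual_idx_def)

lemma dual_idx_eq: "s \<in> cgidx n \<Longrightarrow> t \<in> cgidx n \<Longrightarrow> dual_idx s = dual_idx t \<longleftrightarrow> s = t"
  by (auto simp: cgidx_def dual_idx_def)

lemma cnj_cgv [simp]: "cnj (cgv n s x) = cgv n s x"
  by (simp add: cgv_def split: prod.splits)

lemma cgv_orthonormal:
  assumes "s \<in> cgidx n" "t \<in> cgidx n"
  shows "(\<Sum>x\<in>grid n. cgv n s x * cgv n t x) = (if s = t then 1 else 0)"
  using cg_orthonormal[of "fst s" "snd s" n "fst t" "snd t"] assms
  by (simp add: pair2_grid cgv_def case_prod_unfold prod_eq_iff)

text \<open>The coefficients of the normalised singlet in the tensor square of spin
  \<open>J\<close>: the alternating sign makes it invariant, the root makes it a unit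
  vector.\<close>

definition inv_coef :: "nat \<times> nat \<Rightarrow> complex" where
  "inv_coef = (\<lambda>(J, k). (-1) ^ k * complex_of_real (1 / sqrt (2 * real J + 1)))"

lemma cmod_inv_coef: "(cmod (inv_coef (J, k)))\<^sup>2 = 1 / (2 * real J + 1)"
  by (simp add: inv_coef_def norm_mult norm_divide norm_power power_divide)

definition inv_comb :: "nat \<Rightarrow> (nat \<Rightarrow> complex) \<Rightarrow> tensor4" where
  "inv_comb n z = (\<lambda>(a, b, c, d). \<Sum>s\<in>cgidx n. z (fst s) * inv_coef s * (cgv n s (a, b) * cgv n (dual_idx s) (c, d)))"

lemma inv_comb_pair:
  "inv_comb n z (fst x, snd x, fst y, snd y)
    = (\<Sum>s\<in>cgidx n. z (fst s) * inv_coef s * (cgv n s x * cgv n (dual_idx s) y))"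
  by (simp add: inv_comb_def)

lemma sum_cgidx: "(\<Sum>s\<in>cgidx n. f s) = (\<Sum>J\<le>n. \<Sum>k\<le>2 * J. f (J, k))"
  unfolding cgidx_def by (subst sum.Sigma) auto

lemma inv_comb_nested:
  "inv_comb n z (a, b, c, d) = (\<Sum>J\<le>n. \<Sum>k\<le>2 * J.
     z J * complex_of_real (1 / sqrt (2 * real J + 1)) * ((-1) ^ k * cg n J k a b * cg n J (2 * J - k) c d))"
  unfolding inv_comb_def prod.case sum_cgidx
  by (simp add: inv_coef_def cgv_def dual_idx_def mult_ac)

text \<open>For each \<open>J\<close>, raising the first pair in term \<open>k + 1\<close> yields
  the same product as raising the second pair in term \<open>k\<close>, and the alternating signs
  cancel them. The two unmatched terms contain a raised highest weight vector.\<close>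

lemma raise4_inv_comb: "raise4 n (inv_comb n z) (a, b, c, d) = 0"
proof -
  let ?t = "\<lambda>J. z J * complex_of_real (1 / sqrt (2 * real J + 1))"
  have 1: "raise2 n (\<lambda>x y. inv_comb n z (x, y, c, d)) a b = (\<Sum>J\<le>n. \<Sum>k\<le>2 * J.
     ?t J * ((-1) ^ k * raise2 n (cg n J k) a b * cg n J (2 * J - k) c d))"
  proof -
    have "raise2 n (\<lambda>x y. inv_comb n z (x, y, c, d)) a b = (\<Sum>J\<le>n. \<Sum>k\<le>2 * J.
      raise2 n (\<lambda>a b. (?t J * (-1) ^ k * cg n J (2 * J - k) c d) * cg n J k a b) a b)"
      unfolding inv_comb_nested by (simp add: raise2_sum mult_ac)
    then show ?thesis by (simp only: raise2_scale) (simp add: mult_ac)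
  qed
  have 2: "raise2 n (\<lambda>x y. inv_comb n z (a, b, x, y)) c d = (\<Sum>J\<le>n. \<Sum>k\<le>2 * J.
     ?t J * ((-1) ^ k * cg n J k a b * raise2 n (cg n J (2 * J - k)) c d))"
  proof -
    have "raise2 n (\<lambda>x y. inv_comb n z (a, b, x, y)) c d = (\<Sum>J\<le>n. \<Sum>k\<le>2 * J.
      raise2 n (\<lambda>c d. (?t J * (-1) ^ k * cg n J k a b) * cg n J (2 * J - k) c d) c d)"
      unfolding inv_comb_nested by (simp add: raise2_sum mult_ac)
    then show ?thesis by (simp only: raise2_scale) (simp add: mult_ac)
  qed
  have "(\<Sum>k\<le>2 * J. (-1) ^ k * raise2 n (cg n J k) a b * cg n J (2 * J - k) c d)
      + (\<Sum>k\<le>2 * J. (-1) ^ k * cg n J k a b * raise2 n (cg n J (2 * J - k)) c d) = 0"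
    (is "?A + ?B = 0") if J: "J \<le> n" for J
  proof -
    have "?A = (\<Sum>k<2 * J. (-1) ^ Suc k * raise2 n (cg n J (Suc k)) a b * cg n J (2 * J - Suc k) c d)"
      by (subst sum.atMost_shift) (simp add: raise2_cg_0)
    also have "\<dots> = (\<Sum>k<2 * J. - ((-1) ^ k * (ladder (2 * J) k * cg n J k a b * cg n J (2 * J - Suc k) c d)))"
      using J by (intro sum.cong refl) (simp add: raise2_cg)
    finally have A: "?A = (\<Sum>k<2 * J. - ((-1) ^ k * (ladder (2 * J) k * cg n J k a b * cg n J (2 * J - Suc k) c d)))" .
    have "?B = (\<Sum>k<2 * J. (-1) ^ k * cg n J k a b * raise2 n (cg n J (2 * J - k)) c d)"
      unfolding lessThan_Suc_atMost[symmetric] sum.lessThan_Suc by (simp add: raise2_cg_0)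
    also have "\<dots> = (\<Sum>k<2 * J. (-1) ^ k * (ladder (2 * J) k * cg n J k a b * cg n J (2 * J - Suc k) c d))"
    proof (intro sum.cong refl)
      fix k assume "k \<in> {..<2 * J}"
      then have k: "k < 2 * J" "2 * J - k = Suc (2 * J - Suc k)" by auto
      show "(-1) ^ k * cg n J k a b * raise2 n (cg n J (2 * J - k)) c d
          = (-1) ^ k * (ladder (2 * J) k * cg n J k a b * cg n J (2 * J - Suc k) c d)"
        using J k(1) unfolding k(2) by (subst raise2_cg) (simp_all add: ladder_reflect)
    qed
    finally show ?thesis unfolding A sum_negf by simp
  qed
  then show ?thesis
    unfolding raise4_def prod.case 1 2 sum_distrib_left[symmetric] sum.distrib[symmetric] distrib_left[symmetric]
    by simp
qed

text \<open>The same cancellation read from the other end: the unmatched terms contain a lowered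
  lowest weight vector.\<close>

lemma lower4_inv_comb: "lower4 n (inv_comb n z) (a, b, c, d) = 0"
proof -
  let ?t = "\<lambda>J. z J * complex_of_real (1 / sqrt (2 * real J + 1))"
  have 1: "lower2 n (\<lambda>x y. inv_comb n z (x, y, c, d)) a b = (\<Sum>J\<le>n. \<Sum>k\<le>2 * J.
     ?t J * ((-1) ^ k * lower2 n (cg n J k) a b * cg n J (2 * J - k) c d))"
  proof -
    have "lower2 n (\<lambda>x y. inv_comb n z (x, y, c, d)) a b = (\<Sum>J\<le>n. \<Sum>k\<le>2 * J.
      lower2 n (\<lambda>a b. (?t J * (-1) ^ k * cg n J (2 * J - k) c d) * cg n J k a b) a b)"
      unfolding inv_comb_nested by (simp add: lower2_sum mult_ac)
    then show ?thesis by (simp only: lower2_scale) (simp add: mult_ac)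
  qed
  have 2: "lower2 n (\<lambda>x y. inv_comb n z (a, b, x, y)) c d = (\<Sum>J\<le>n. \<Sum>k\<le>2 * J.
     ?t J * ((-1) ^ k * cg n J k a b * lower2 n (cg n J (2 * J - k)) c d))"
  proof -
    have "lower2 n (\<lambda>x y. inv_comb n z (a, b, x, y)) c d = (\<Sum>J\<le>n. \<Sum>k\<le>2 * J.
      lower2 n (\<lambda>c d. (?t J * (-1) ^ k * cg n J k a b) * cg n J (2 * J - k) c d) c d)"
      unfolding inv_comb_nested by (simp add: lower2_sum mult_ac)
    then show ?thesis by (simp only: lower2_scale) (simp add: mult_ac)
  qed
  have "(\<Sum>k\<le>2 * J. (-1) ^ k * lower2 n (cg n J k) a b * cg n J (2 * J - k) c d)
      + (\<Sum>k\<le>2 * J. (-1) ^ k * cg n J k a b * lower2 n (cg n J (2 * J - k)) c d) = 0"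
    (is "?A + ?B = 0") if J: "J \<le> n" for J
  proof -
    have "?A = (\<Sum>k<2 * J. (-1) ^ k * lower2 n (cg n J k) a b * cg n J (2 * J - k) c d)"
      unfolding lessThan_Suc_atMost[symmetric] sum.lessThan_Suc using J by (simp add: lower2_cg)
    also have "\<dots> = (\<Sum>k<2 * J. (-1) ^ k * (ladder (2 * J) k * cg n J (Suc k) a b * cg n J (2 * J - k) c d))"
      using J by (intro sum.cong refl) (simp add: lower2_cg)
    finally have A: "?A = (\<Sum>k<2 * J. (-1) ^ k * (ladder (2 * J) k * cg n J (Suc k) a b * cg n J (2 * J - k) c d))" .
    have "?B = (\<Sum>k<2 * J. (-1) ^ Suc k * cg n J (Suc k) a b * lower2 n (cg n J (2 * J - Suc k)) c d)"
      using J by (subst sum.atMost_shift) (simp add: lower2_cg)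
    also have "\<dots> = (\<Sum>k<2 * J. - ((-1) ^ k * (ladder (2 * J) k * cg n J (Suc k) a b * cg n J (2 * J - k) c d)))"
    proof (intro sum.cong refl)
      fix k assume "k \<in> {..<2 * J}"
      then have k: "k < 2 * J" "Suc (2 * J - Suc k) = 2 * J - k" by auto
      show "(-1) ^ Suc k * cg n J (Suc k) a b * lower2 n (cg n J (2 * J - Suc k)) c d
          = - ((-1) ^ k * (ladder (2 * J) k * cg n J (Suc k) a b * cg n J (2 * J - k) c d))"
        using J k by (subst lower2_cg) (simp_all add: ladder_reflect)
    qed
    finally show ?thesis unfolding A sum_negf by simp
  qed
  then show ?thesis
    unfolding lower4_def prod.case 1 2 sum_distrib_left[symmetric] sum.distrib[symmetric] distrib_left[symmetric]
    by simp
qed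

lemma inv_comb_in_H_inv: "inv_comb n z \<in> H_inv n"
proof -
  have zero: "inv_comb n z (a, b, c, d) = 0"
    if "\<And>J k. k \<le> 2 * J \<Longrightarrow> cg n J k a b = 0 \<or> cg n J (2 * J - k) c d = 0" for a b c d
    unfolding inv_comb_nested using that by (intro sum.neutral ballI) fastforce
  have "inv_comb n z \<in> tensor_space4 n"
    unfolding tensor_space4_def mem_Collect_eq
  proof (intro allI impI)
    fix i assume i: "i \<notin> idx4 n"
    obtain a b c d where abcd: "i = (a, b, c, d)" by (cases i)
    show "inv_comb n z i = 0"
      unfolding abcd using i supp2_cg unfolding abcd
      by (intro zero) (auto simp: idx4_def supp2_def not_le)
  qed
  moreover have "a + b + c + d = 2 * n" if nz: "inv_comb n z (a, b, c, d) \<noteq> 0" for a b c d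
  proof -
    obtain J k where "k \<le> 2 * J" "cg n J k a b \<noteq> 0" "cg n J (2 * J - k) c d \<noteq> 0"
      using zero nz by blast
    then show ?thesis
      using weight_cg[of a b k n J] weight_cg[of c d "2 * J - k" n J] by fastforce
  qed
  ultimately show ?thesis
    unfolding H_inv_iff using raise4_inv_comb lower4_inv_comb by fastforce
qed

section \<open>Every invariant tensor is a combination of the singlets\<close>

lemma cg_expansion:
  assumes "a \<le> n" "b \<le> n"
  shows "f a b = (\<Sum>s\<in>cgidx n. pair2 n (cg n (fst s) (snd s)) f * cgv n s (a, b))"
proof -
  have "(\<Sum>s\<in>cgidx n. pair2 n (cg n (fst s) (snd s)) f * cgv n s (a, b))
      = (\<Sum>s\<in>cgidx n. \<Sum>x\<in>grid n. f (fst x) (snd x) * (cgv n s (a, b) * cgv n s x))"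
    unfolding pair2_grid sum_distrib_right
    by (intro sum.cong refl) (simp add: case_prod_unfold cgv_def mult_ac)
  also have "\<dots> = (\<Sum>(a', b')\<in>grid n. \<Sum>s\<in>cgidx n. f a' b' * (cgv n s (a, b) * cgv n s (a', b')))"
    by (subst sum.swap) (simp add: case_prod_unfold)
  also have "\<dots> = (\<Sum>(a', b')\<in>grid n. if (a', b') = (a, b) then f a' b' else 0)"
  proof (intro sum.cong refl, clarify)
    fix a' b' assume "(a', b') \<in> grid n"
    then have "(\<Sum>s\<in>cgidx n. cgv n s (a, b) * cgv n s (a', b')) = (if a = a' \<and> b = b' then 1 else 0)"
      using cg_complete[of a n b a' b'] assms by (simp add: cgv_def case_prod_unfold grid_def)
    then show "(\<Sum>s\<in>cgidx n. f a' b' * (cgv n s (a, b) * cgv n s (a', b')))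
        = (if (a', b') = (a, b) then f a' b' else 0)"
      unfolding sum_distrib_left[symmetric] by auto
  qed
  also have "\<dots> = (\<Sum>x\<in>grid n. if x = (a, b) then f a b else 0)"
    by (intro sum.cong refl) (simp split: prod.split)
  also have "\<dots> = f a b" using assms by (simp add: grid_def)
  finally show ?thesis ..
qed

text \<open>On the line of fixed \<open>k + l\<close> through the middle weight, the relation at
  \<open>k = N\<close> has a single term because \<open>ladder N N\<close> is zero; from there zeros
  propagate downwards in \<open>k\<close>. The inequality \<open>N < M\<close> keeps
  \<open>l\<close> strictly between 0 and \<open>M\<close>, so the factor to be cancelled is
  nonzero.\<close>

lemma ladder_vanish:
  fixes c :: "nat \<Rightarrow> nat \<Rightarrow> complex"
  assumes rel: "\<And>k l. k \<le> N \<Longrightarrow> l \<le> M \<Longrightarrow> ladder N k * c (Suc k) l + ladder M l * c k (Suc l) = 0"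
    and "N < M"
  shows "k \<le> N \<Longrightarrow> 2 * (k + l) = N + M \<Longrightarrow> c k l = 0"
proof (induction "N - k" arbitrary: k l)
  case 0
  then have k: "k = N" by simp
  obtain l' where l: "l = Suc l'" using 0 k \<open>N < M\<close> by (cases l) auto
  have "ladder M l' * c k l = 0"
    using rel[of N l'] 0 k l \<open>N < M\<close> by simp
  then show ?case using ladder_nonzero[of l' M] l 0 k \<open>N < M\<close> by simp
next
  case (Suc i)
  then have k: "k < N" by simp
  obtain l' where l: "l = Suc l'" using Suc k \<open>N < M\<close> by (cases l) auto
  have "c (Suc k) l' = 0" using Suc.hyps(1)[of "Suc k" l'] Suc k l by simp
  then have "ladder M l' * c k l = 0"
    using rel[of k l'] Suc k l \<open>N < M\<close> by simp
  then show ?case using ladder_nonzero[of l' M] l Suc k \<open>N < M\<close> by simp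
qed

text \<open>The coefficients of an invariant tensor in the product Clebsch-Gordan basis satisfy a
  two-term recursion along lines of fixed weight; between different spins it starts from zero.\<close>

lemma H_inv_coefficients:
  assumes \<psi>: "\<psi> \<in> H_inv n"
  defines "C \<equiv> \<lambda>J k J' k'. pair2 n (cg n J k) (\<lambda>a b. pair2 n (cg n J' k') (\<lambda>c d. \<psi> (a, b, c, d)))"
  assumes s: "(J, k) \<in> cgidx n" "(J', k') \<in> cgidx n"
  shows "C J k J' k' = (if (J', k') = (J, 2 * J - k) then (-1) ^ k * C J 0 J (2 * J) else 0)"
proof -
  from \<psi> have wt: "\<And>a b c d. \<psi> (a, b, c, d) \<noteq> 0 \<Longrightarrow> a + b + c + d = 2 * n"
    and r4: "\<And>i. i \<in> idx4 n \<Longrightarrow> raise4 n \<psi> i = 0"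
    unfolding H_inv_iff by auto
  have weight: "C J k J' k' = 0" if "k + k' \<noteq> J + J'" for J k J' k'
  proof -
    have "cg n J k a b * (cg n J' k' c d * \<psi> (a, b, c, d)) = 0" for a b c d
      using weight_cg[of a b k n J] weight_cg[of c d k' n J'] wt[of a b c d] that by fastforce
    then show ?thesis unfolding C_def pair2_def sum_distrib_left by (intro sum.neutral ballI)
  qed
  have rel: "ladder (2 * J) k * C J (Suc k) J' k' + ladder (2 * J') k' * C J k J' (Suc k') = 0"
    if "J \<le> n" "J' \<le> n" "k \<le> 2 * J" "k' \<le> 2 * J'" for J k J' k'
  proof -
    have l: "lower2 n (cg n J k) = (\<lambda>a b. ladder (2 * J) k * cg n J (Suc k) a b)" if "J \<le> n" "k \<le> 2 * J" for J k
      using lower2_cg[OF that] by (intro ext)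
    have adj: "pair2 n f (raise2 n g) = pair2 n (lower2 n f) g" for f g
      by (metis pair2_commute pair2_raise)
    have "pair2 n (cg n J k) (\<lambda>a b. pair2 n (cg n J' k') (\<lambda>c d. raise2 n (\<lambda>x y. \<psi> (x, y, c, d)) a b))
        = pair2 n (cg n J k) (raise2 n (\<lambda>a b. pair2 n (cg n J' k') (\<lambda>c d. \<psi> (a, b, c, d))))"
    proof (rule arg_cong[of _ _ "pair2 n (cg n J k)"], intro ext)
      fix a b
      have "raise2 n (\<lambda>a b. pair2 n (cg n J' k') (\<lambda>c d. \<psi> (a, b, c, d))) a b
          = (\<Sum>c\<le>n. \<Sum>d\<le>n. raise2 n (\<lambda>a b. cg n J' k' c d * \<psi> (a, b, c, d)) a b)"
        unfolding pair2_def by (simp add: raise2_sum)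
      then show "pair2 n (cg n J' k') (\<lambda>c d. raise2 n (\<lambda>x y. \<psi> (x, y, c, d)) a b)
          = raise2 n (\<lambda>a b. pair2 n (cg n J' k') (\<lambda>c d. \<psi> (a, b, c, d))) a b"
        by (simp add: raise2_scale pair2_def)
    qed
    then have 1: "pair2 n (cg n J k) (\<lambda>a b. pair2 n (cg n J' k') (\<lambda>c d. raise2 n (\<lambda>x y. \<psi> (x, y, c, d)) a b))
        = ladder (2 * J) k * C J (Suc k) J' k'"
      unfolding adj l[OF that(1,3)] pair2_scale_left C_def .
    have "pair2 n (cg n J' k') (\<lambda>c d. raise2 n (\<lambda>x y. \<psi> (a, b, x, y)) c d)
        = ladder (2 * J') k' * pair2 n (cg n J' (Suc k')) (\<lambda>c d. \<psi> (a, b, c, d))" for a b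
      using adj[of "cg n J' k'" "\<lambda>x y. \<psi> (a, b, x, y)"] unfolding l[OF that(2,4)] pair2_scale_left by simp
    then have 2: "pair2 n (cg n J k) (\<lambda>a b. pair2 n (cg n J' k') (\<lambda>c d. raise2 n (\<lambda>x y. \<psi> (a, b, x, y)) c d))
        = ladder (2 * J') k' * C J k J' (Suc k')"
      unfolding C_def by (simp add: pair2_def[of n "cg n J k"] sum_distrib_left mult_ac)
    have "0 = pair2 n (cg n J k) (\<lambda>a b. pair2 n (cg n J' k') (\<lambda>c d. raise4 n \<psi> (a, b, c, d)))"
      unfolding pair2_def by (simp add: r4 idx4_def)
    also have "\<dots> = pair2 n (cg n J k) (\<lambda>a b. pair2 n (cg n J' k') (\<lambda>c d. raise2 n (\<lambda>x y. \<psi> (x, y, c, d)) a b))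
       + pair2 n (cg n J k) (\<lambda>a b. pair2 n (cg n J' k') (\<lambda>c d. raise2 n (\<lambda>x y. \<psi> (a, b, x, y)) c d))"
      unfolding raise4_def prod.case pair2_def by (simp only: distrib_left sum.distrib)
    finally show ?thesis unfolding 1 2 ..
  qed
  have J: "J \<le> n" "J' \<le> n" "k \<le> 2 * J" "k' \<le> 2 * J'" using s by (auto simp: cgidx_def)
  show ?thesis
  proof (cases "k + k' = J + J'")
    case False
    then show ?thesis using weight[of k k' J J'] J by auto
  next
    case True
    consider "J < J'" | "J' < J" | "J = J'" by linarith
    then show ?thesis
    proof cases
      case 1
      have "C J k J' k' = 0"
        by (rule ladder_vanish[of "2 * J" "2 * J'" "\<lambda>k k'. C J k J' k'"]) (use 1 J True rel in auto)
      then show ?thesis using 1 by simp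
    next
      case 2
      have "ladder (2 * J') l * C J k J' (Suc l) + ladder (2 * J) k * C J (Suc k) J' l = 0"
        if "l \<le> 2 * J'" "k \<le> 2 * J" for k l
        using rel[OF J(1,2) that(2,1)] by (simp add: add.commute)
      then have "C J k J' k' = 0"
        by (rule ladder_vanish[of "2 * J'" "2 * J" "\<lambda>k' k. C J k J' k'"]) (use 2 J True in auto)
      then show ?thesis using 2 by simp
    next
      case 3
      \<comment> \<open>For equal spins the two ladder factors coincide by reflection and cancel,
        leaving only a change of sign at each step.\<close>
      have "C J k J (2 * J - k) = (-1) ^ k * C J 0 J (2 * J)" if "k \<le> 2 * J" for k
        using that
      proof (induction k)
        case (Suc k)
        then have k: "k < 2 * J" and e: "Suc (2 * J - Suc k) = 2 * J - k" by auto
        have "ladder (2 * J) k * (C J (Suc k) J (2 * J - Suc k) + C J k J (2 * J - k)) = 0"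
          using rel[of J J k "2 * J - Suc k"] J k by (simp add: e ladder_reflect distrib_left)
        then have "C J (Suc k) J (2 * J - Suc k) = - C J k J (2 * J - k)"
          using ladder_nonzero[OF k] by (simp add: add_eq_0_iff2)
        then show ?case using Suc by simp
      qed simp
      moreover have "k' = 2 * J - k" using 3 True J by simp
      ultimately show ?thesis using 3 J by simp
    qed
  qed
qed

lemma H_inv_eq_inv_comb:
  assumes \<psi>: "\<psi> \<in> H_inv n"
  obtains z where "\<psi> = inv_comb n z"
proof -
  define C where "C = (\<lambda>J k J' k'. pair2 n (cg n J k) (\<lambda>a b. pair2 n (cg n J' k') (\<lambda>c d. \<psi> (a, b, c, d))))"
  \<comment> \<open>The root undoes the normalisation contained in \<open>inv_coef\<close>.\<close>
  define z where "z = (\<lambda>J. C J 0 J (2 * J) * complex_of_real (sqrt (2 * real J + 1)))"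
  have "\<psi> (a, b, c, d) = inv_comb n z (a, b, c, d)" if i: "(a, b, c, d) \<in> idx4 n" for a b c d
  proof -
    have r: "a \<le> n" "b \<le> n" "c \<le> n" "d \<le> n" using i by (auto simp: idx4_def)
    have "\<psi> (a, b, c, d) = (\<Sum>t\<in>cgidx n. pair2 n (cg n (fst t) (snd t)) (\<lambda>c d. \<psi> (a, b, c, d)) * cgv n t (c, d))"
      by (rule cg_expansion[OF r(3,4)])
    also have "\<dots> = (\<Sum>t\<in>cgidx n. (\<Sum>s\<in>cgidx n. C (fst s) (snd s) (fst t) (snd t) * cgv n s (a, b)) * cgv n t (c, d))"
    proof (intro sum.cong refl arg_cong2[of _ _ _ _ "(*)"])
      fix t
      show "pair2 n (cg n (fst t) (snd t)) (\<lambda>c d. \<psi> (a, b, c, d))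
          = (\<Sum>s\<in>cgidx n. C (fst s) (snd s) (fst t) (snd t) * cgv n s (a, b))"
        unfolding C_def
        by (rule cg_expansion[OF r(1,2), of "\<lambda>a b. pair2 n (cg n (fst t) (snd t)) (\<lambda>c d. \<psi> (a, b, c, d))"])
    qed
    also have "\<dots> = (\<Sum>s\<in>cgidx n. \<Sum>t\<in>cgidx n. C (fst s) (snd s) (fst t) (snd t) * cgv n s (a, b) * cgv n t (c, d))"
      by (subst sum.swap) (simp add: sum_distrib_right)
    also have "\<dots> = (\<Sum>s\<in>cgidx n. \<Sum>t\<in>cgidx n. if t = dual_idx s
        then (-1) ^ snd s * C (fst s) 0 (fst s) (2 * fst s) * cgv n s (a, b) * cgv n t (c, d) else 0)"
    proof (intro sum.cong refl)
      fix s t assume "s \<in> cgidx n" "t \<in> cgidx n"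
      then show "C (fst s) (snd s) (fst t) (snd t) * cgv n s (a, b) * cgv n t (c, d) = (if t = dual_idx s
        then (-1) ^ snd s * C (fst s) 0 (fst s) (2 * fst s) * cgv n s (a, b) * cgv n t (c, d) else 0)"
        using H_inv_coefficients[OF \<psi>, of "fst s" "snd s" "fst t" "snd t"]
        by (auto simp: C_def dual_idx_def case_prod_unfold prod_eq_iff)
    qed
    also have "\<dots> = (\<Sum>s\<in>cgidx n. (-1) ^ snd s * C (fst s) 0 (fst s) (2 * fst s) * cgv n s (a, b) * cgv n (dual_idx s) (c, d))"
      by (simp add: dual_idx_in)
    also have "\<dots> = inv_comb n z (a, b, c, d)"
      unfolding inv_comb_def prod.case
    proof (intro sum.cong refl)
      fix s :: "nat \<times> nat"
      have "complex_of_real (sqrt (2 * real (fst s) + 1)) * complex_of_real (1 / sqrt (2 * real (fst s) + 1)) = 1"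
        unfolding of_real_mult[symmetric] by (simp add: add_nonneg_eq_0_iff)
      then have "z (fst s) * inv_coef s = (-1) ^ snd s * C (fst s) 0 (fst s) (2 * fst s)"
        by (simp add: z_def inv_coef_def case_prod_unfold mult_ac del: of_real_divide)
      then show "(-1) ^ snd s * C (fst s) 0 (fst s) (2 * fst s) * cgv n s (a, b) * cgv n (dual_idx s) (c, d)
          = z (fst s) * inv_coef s * (cgv n s (a, b) * cgv n (dual_idx s) (c, d))"
        by (simp only: mult.assoc[symmetric])
    qed
    finally show ?thesis .
  qed
  moreover have "\<psi> i = inv_comb n z i" if "i \<notin> idx4 n" for i
    using that \<psi> inv_comb_in_H_inv[of n z] unfolding H_inv_iff tensor_space4_def by (cases i) simp
  ultimately have "\<psi> = inv_comb n z" by (metis (no_types, opaque_lifting) ext prod_cases4)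
  then show ?thesis by (rule that)
qed

section \<open>Inner product, reduced state and purity in the singlet basis\<close>

lemma cinner4_inv_comb: "cinner4 n (inv_comb n z) (inv_comb n z') = (\<Sum>J\<le>n. cnj (z J) * z' J)"
proof -
  let ?b = "\<lambda>s. cnj (z (fst s) * inv_coef s)" and ?b' = "\<lambda>s. z' (fst s) * inv_coef s"
  have "cinner4 n (inv_comb n z) (inv_comb n z')
      = (\<Sum>x\<in>grid n. \<Sum>y\<in>grid n. \<Sum>s\<in>cgidx n. \<Sum>t\<in>cgidx n. ?b s * ?b' t *
          ((cgv n s x * cgv n t x) * (cgv n (dual_idx s) y * cgv n (dual_idx t) y)))"
    unfolding cinner4_def sum_idx4 case_prod_unfold inv_comb_pair cnj_sum sum_product
    by (simp add: mult_ac)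
  also have "\<dots> = (\<Sum>s\<in>cgidx n. \<Sum>t\<in>cgidx n. \<Sum>x\<in>grid n. \<Sum>y\<in>grid n. ?b s * ?b' t *
          ((cgv n s x * cgv n t x) * (cgv n (dual_idx s) y * cgv n (dual_idx t) y)))"
    by (simp only: sum.swap[of _ "cgidx n" "grid n"])
  also have "\<dots> = (\<Sum>s\<in>cgidx n. \<Sum>t\<in>cgidx n. ?b s * ?b' t * ((\<Sum>x\<in>grid n. cgv n s x * cgv n t x)
      * (\<Sum>y\<in>grid n. cgv n (dual_idx s) y * cgv n (dual_idx t) y)))"
    by (simp only: sum_product) (simp only: sum_distrib_left)
  also have "\<dots> = (\<Sum>s\<in>cgidx n. \<Sum>t\<in>cgidx n. if t = s then ?b s * ?b' s else 0)"
    by (intro sum.cong refl) (auto simp: cgv_orthonormal dual_idx_in dual_idx_eq)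
  also have "\<dots> = (\<Sum>s\<in>cgidx n. cnj (z (fst s)) * z' (fst s) * complex_of_real ((cmod (inv_coef s))\<^sup>2))"
    unfolding complex_norm_square by (simp add: mult_ac)
  also have "\<dots> = (\<Sum>J\<le>n. cnj (z J) * z' J)"
    unfolding sum_cgidx
  proof (intro sum.cong refl)
    fix J
    have "complex_of_real (2 * real J + 1) \<noteq> 0"
      unfolding of_real_eq_0_iff by linarith
    then have "2 * complex_of_nat J + 1 \<noteq> 0" by simp
    then show "(\<Sum>k\<le>2 * J. cnj (z (fst (J, k))) * z' (fst (J, k)) * complex_of_real ((cmod (inv_coef (J, k)))\<^sup>2))
        = cnj (z J) * z' J"
      by (simp add: cmod_inv_coef add.commute)
  qed
  finally show ?thesis .
qed

lemma trace2_grid: "trace2 n A = (\<Sum>x\<in>grid n. A x x)"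
  by (simp add: trace2_def grid_def)

lemma rho34_grid:
  "rho34 n \<psi> x y = (\<Sum>w\<in>grid n. \<psi> (fst w, snd w, fst x, snd x) * cnj (\<psi> (fst w, snd w, fst y, snd y)))"
  by (simp add: rho34_def partial_trace12_def ketbra_def case_prod_unfold grid_def sum.cartesian_product')

text \<open>Orthonormality on the traced pair removes all cross terms. What remains is the spectral
  decomposition of the reduced state, with the dual Clebsch-Gordan vectors as eigenvectors.\<close>

lemma rho34_inv_comb:
  "rho34 n (inv_comb n z) x y = (\<Sum>s\<in>cgidx n. complex_of_real ((cmod (z (fst s) * inv_coef s))\<^sup>2)
     * (cgv n (dual_idx s) x * cgv n (dual_idx s) y))"
proof -
  let ?b = "\<lambda>s. z (fst s) * inv_coef s"
  have "rho34 n (inv_comb n z) x y = (\<Sum>w\<in>grid n. \<Sum>s\<in>cgidx n. \<Sum>t\<in>cgidx n. ?b s * cnj (?b t) *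
          ((cgv n s w * cgv n t w) * (cgv n (dual_idx s) x * cgv n (dual_idx t) y)))"
    unfolding rho34_grid inv_comb_pair cnj_sum sum_product by (simp add: mult_ac)
  also have "\<dots> = (\<Sum>s\<in>cgidx n. \<Sum>t\<in>cgidx n. \<Sum>w\<in>grid n. ?b s * cnj (?b t) *
          ((cgv n s w * cgv n t w) * (cgv n (dual_idx s) x * cgv n (dual_idx t) y)))"
    by (simp only: sum.swap[of _ "cgidx n" "grid n"])
  also have "\<dots> = (\<Sum>s\<in>cgidx n. \<Sum>t\<in>cgidx n. ?b s * cnj (?b t) * ((\<Sum>w\<in>grid n. cgv n s w * cgv n t w)
      * (cgv n (dual_idx s) x * cgv n (dual_idx t) y)))"
    by (simp only: sum_distrib_left sum_distrib_right)
  also have "\<dots> = (\<Sum>s\<in>cgidx n. \<Sum>t\<in>cgidx n. if t = s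
      then ?b s * cnj (?b s) * (cgv n (dual_idx s) x * cgv n (dual_idx s) y) else 0)"
    by (intro sum.cong refl) (auto simp: cgv_orthonormal)
  also have "\<dots> = (\<Sum>s\<in>cgidx n. ?b s * cnj (?b s) * (cgv n (dual_idx s) x * cgv n (dual_idx s) y))"
    by simp
  finally show ?thesis unfolding complex_norm_square .
qed

lemma trace2_rho34: "trace2 n (rho34 n (inv_comb n z)) = complex_of_real (\<Sum>J\<le>n. (cmod (z J))\<^sup>2)"
proof -
  have "trace2 n (rho34 n (inv_comb n z)) = cinner4 n (inv_comb n z) (inv_comb n z)"
    unfolding trace2_grid rho34_grid cinner4_def sum_idx4 case_prod_unfold
    by (subst sum.swap) (simp add: mult.commute)
  then show ?thesis
    unfolding cinner4_inv_comb of_real_sum complex_norm_square by (simp add: mult.commute)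
qed

text \<open>The eigenvalue belonging to \<open>J\<close> is the squared modulus of
  \<open>z J\<close> divided by \<open>2 * J + 1\<close>, with multiplicity
  \<open>2 * J + 1\<close>; squaring it and counting leaves one factor
  \<open>1 / (2 * J + 1)\<close>.\<close>

lemma trace2_rho34_square:
  "trace2 n (mult2 n (rho34 n (inv_comb n z)) (rho34 n (inv_comb n z)))
    = complex_of_real (\<Sum>J\<le>n. 1 / (2 * real J + 1) * ((cmod (z J))\<^sup>2)\<^sup>2)"
proof -
  let ?g = "\<lambda>s. (cmod (z (fst s) * inv_coef s))\<^sup>2"
  have "trace2 n (mult2 n (rho34 n (inv_comb n z)) (rho34 n (inv_comb n z)))
     = (\<Sum>x\<in>grid n. \<Sum>y\<in>grid n. \<Sum>s\<in>cgidx n. \<Sum>t\<in>cgidx n. complex_of_real (?g s * ?g t) *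
         ((cgv n (dual_idx s) x * cgv n (dual_idx t) x) * (cgv n (dual_idx s) y * cgv n (dual_idx t) y)))"
    unfolding trace2_grid mult2_def grid_def[symmetric] rho34_inv_comb
    by (simp only: sum_product of_real_mult) (simp only: mult_ac)
  also have "\<dots> = (\<Sum>s\<in>cgidx n. \<Sum>t\<in>cgidx n. \<Sum>x\<in>grid n. \<Sum>y\<in>grid n. complex_of_real (?g s * ?g t) *
         ((cgv n (dual_idx s) x * cgv n (dual_idx t) x) * (cgv n (dual_idx s) y * cgv n (dual_idx t) y)))"
    by (simp only: sum.swap[of _ "cgidx n" "grid n"])
  also have "\<dots> = (\<Sum>s\<in>cgidx n. \<Sum>t\<in>cgidx n. complex_of_real (?g s * ?g t) *
      ((\<Sum>x\<in>grid n. cgv n (dual_idx s) x * cgv n (dual_idx t) x)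
      * (\<Sum>y\<in>grid n. cgv n (dual_idx s) y * cgv n (dual_idx t) y)))"
    by (simp only: sum_product) (simp only: sum_distrib_left)
  also have "\<dots> = (\<Sum>s\<in>cgidx n. \<Sum>t\<in>cgidx n. if t = s then complex_of_real (?g s * ?g s) else 0)"
    by (intro sum.cong refl) (auto simp: cgv_orthonormal dual_idx_in dual_idx_eq)
  also have "\<dots> = complex_of_real (\<Sum>s\<in>cgidx n. ?g s * ?g s)" by simp
  also have "(\<Sum>s\<in>cgidx n. ?g s * ?g s) = (\<Sum>J\<le>n. 1 / (2 * real J + 1) * ((cmod (z J))\<^sup>2)\<^sup>2)"
    unfolding sum_cgidx
  proof (intro sum.cong refl)
    fix J
    have alg: "r * (q / r * (q / r)) = 1 / r * q\<^sup>2" if "r > 0" for r q :: real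
      using that by (simp add: power2_eq_square)
    show "(\<Sum>k\<le>2 * J. ?g (J, k) * ?g (J, k)) = 1 / (2 * real J + 1) * ((cmod (z J))\<^sup>2)\<^sup>2"
      using alg[of "2 * real J + 1" "(cmod (z J))\<^sup>2"]
      by (simp add: norm_mult power_mult_distrib cmod_inv_coef add.commute)
  qed
  finally show ?thesis .
qed

lemma S2_inv_comb:
  assumes "(\<Sum>J\<le>n. (cmod (z J))\<^sup>2) = 1"
  shows "S2 n (inv_comb n z) = - ln (\<Sum>J\<le>n. 1 / (2 * real J + 1) * ((cmod (z J))\<^sup>2)\<^sup>2)"
  unfolding S2_def trace2_rho34 trace2_rho34_square Re_complex_of_real assms by simp

section \<open>Haar measure and concentration\<close>

text \<open>An inner product rather than a chosen preimage under \<open>inv_comb\<close>, so that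
  linearity and continuity are immediate.\<close>

definition coord :: "nat \<Rightarrow> nat \<Rightarrow> tensor4 \<Rightarrow> complex" where
  "coord n J \<psi> = cinner4 n (inv_comb n (\<lambda>K. if K = J then 1 else 0)) \<psi>"

lemma coord_inv_comb: "J \<le> n \<Longrightarrow> coord n J (inv_comb n z) = z J"
proof -
  assume "J \<le> n"
  have "cnj (if K = J then 1 else 0) * z K = (if K = J then z K else 0)" for K by simp
  then show ?thesis using \<open>J \<le> n\<close> unfolding coord_def cinner4_inv_comb by simp
qed

lemma inv_comb_cong: "(\<And>J. J \<le> n \<Longrightarrow> z J = z' J) \<Longrightarrow> inv_comb n z = inv_comb n z'"
  unfolding inv_comb_def by (intro ext) (auto simp: cgidx_def intro!: sum.cong split: prod.split)

lemma inv_comb_coord: "\<psi> \<in> H_inv n \<Longrightarrow> inv_comb n (\<lambda>J. coord n J \<psi>) = \<psi>"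
  by (elim H_inv_eq_inv_comb) (auto simp: coord_inv_comb intro: inv_comb_cong)

lemma coord_linear: "coord n J (\<lambda>i. a * \<phi> i + b * \<psi> i) = a * coord n J \<phi> + b * coord n J \<psi>"
  by (simp add: coord_def cinner4_def algebra_simps sum.distrib sum_distrib_left)

lemma inv_comb_linear:
  "inv_comb n (\<lambda>J. a * z J + b * z' J) = (\<lambda>i. a * inv_comb n z i + b * inv_comb n z' i)"
  by (rule ext) (simp add: inv_comb_def algebra_simps sum.distrib sum_distrib_left split: prod.split)

lemma H_inv_linear:
  assumes "\<phi> \<in> H_inv n" "\<psi> \<in> H_inv n"
  shows "(\<lambda>i. a * \<phi> i + b * \<psi> i) \<in> H_inv n"
proof -
  have "(\<lambda>i. a * \<phi> i + b * \<psi> i) = inv_comb n (\<lambda>J. a * coord n J \<phi> + b * coord n J \<psi>)"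
    unfolding inv_comb_linear inv_comb_coord[OF assms(1)] inv_comb_coord[OF assms(2)] ..
  then show ?thesis using inv_comb_in_H_inv by simp
qed

lemma cinner4_coord:
  assumes "\<phi> \<in> H_inv n" "\<psi> \<in> H_inv n"
  shows "cinner4 n \<phi> \<psi> = (\<Sum>J\<le>n. cnj (coord n J \<phi>) * coord n J \<psi>)"
  using cinner4_inv_comb[of n "\<lambda>J. coord n J \<phi>" "\<lambda>J. coord n J \<psi>"]
  by (simp add: inv_comb_coord assms)

text \<open>Restricted because \<open>unitary_group\<close> consists of functions that are
  extensional on \<open>H_inv n\<close>.\<close>

definition matrix_op :: "nat \<Rightarrow> (nat \<Rightarrow> nat \<Rightarrow> complex) \<Rightarrow> tensor4 \<Rightarrow> tensor4" where
  "matrix_op n W = restrict (\<lambda>\<psi>. inv_comb n (\<lambda>J. \<Sum>K\<le>n. W J K * coord n K \<psi>)) (H_inv n)"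

lemma matrix_op_in_H_inv: "\<psi> \<in> H_inv n \<Longrightarrow> matrix_op n W \<psi> \<in> H_inv n"
  by (simp add: matrix_op_def inv_comb_in_H_inv)

lemma coord_matrix_op:
  "\<psi> \<in> H_inv n \<Longrightarrow> J \<le> n \<Longrightarrow> coord n J (matrix_op n W \<psi>) = (\<Sum>K\<le>n. W J K * coord n K \<psi>)"
  by (simp add: matrix_op_def coord_inv_comb)

lemma matrix_op_inverse:
  assumes "\<psi> \<in> H_inv n"
    and "\<And>J K. J \<le> n \<Longrightarrow> K \<le> n \<Longrightarrow> (\<Sum>L\<le>n. V J L * W L K) = (if J = K then 1 else 0)"
  shows "matrix_op n V (matrix_op n W \<psi>) = \<psi>"
proof -
  have "(\<Sum>L\<le>n. V J L * coord n L (matrix_op n W \<psi>)) = coord n J \<psi>" if "J \<le> n" for J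
  proof -
    have "(\<Sum>L\<le>n. V J L * coord n L (matrix_op n W \<psi>)) = (\<Sum>L\<le>n. \<Sum>K\<le>n. V J L * W L K * coord n K \<psi>)"
      by (simp add: coord_matrix_op[OF assms(1)] sum_distrib_left mult.assoc)
    also have "\<dots> = (\<Sum>K\<le>n. (\<Sum>L\<le>n. V J L * W L K) * coord n K \<psi>)"
      by (subst sum.swap) (simp add: sum_distrib_right)
    also have "\<dots> = (\<Sum>K\<le>n. if K = J then coord n K \<psi> else 0)"
      using that by (intro sum.cong refl) (simp add: assms(2))
    finally show ?thesis using that by simp
  qed
  then have "matrix_op n V (matrix_op n W \<psi>) = inv_comb n (\<lambda>J. coord n J \<psi>)"
    using matrix_op_in_H_inv[OF assms(1), of W] unfolding matrix_op_def[of n V]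
    by (auto intro: inv_comb_cong)
  then show ?thesis by (simp add: inv_comb_coord assms(1))
qed

lemma matrix_op_unitary:
  assumes W: "unitary_matrix n W"
  shows "matrix_op n W \<in> unitary_group n"
proof -
  let ?V = "\<lambda>J K. cnj (W K J)"
  have VW: "(\<Sum>L\<le>n. ?V J L * W L K) = (if J = K then 1 else 0)" if "J \<le> n" "K \<le> n" for J K
    using W that by (simp add: unitary_matrix_def)
  have WV: "(\<Sum>L\<le>n. W J L * ?V L K) = (if J = K then 1 else 0)" if "J \<le> n" "K \<le> n" for J K
    using W that by (simp add: unitary_matrix_def)
  have "bij_betw (matrix_op n W) (H_inv n) (H_inv n)"
    by (rule bij_betw_byWitness[of _ "matrix_op n ?V"])
      (auto simp: matrix_op_inverse[OF _ VW] matrix_op_inverse[OF _ WV] matrix_op_in_H_inv)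
  moreover have "matrix_op n W (\<lambda>i. a * \<phi> i + b * \<psi> i) = (\<lambda>i. a * matrix_op n W \<phi> i + b * matrix_op n W \<psi> i)"
    if "\<phi> \<in> H_inv n" "\<psi> \<in> H_inv n" for \<phi> \<psi> a b
  proof -
    have "(\<lambda>J. \<Sum>K\<le>n. W J K * coord n K (\<lambda>i. a * \<phi> i + b * \<psi> i))
        = (\<lambda>J. a * (\<Sum>K\<le>n. W J K * coord n K \<phi>) + b * (\<Sum>K\<le>n. W J K * coord n K \<psi>))"
      by (simp add: coord_linear algebra_simps sum.distrib sum_distrib_left)
    then show ?thesis
      using that by (simp add: matrix_op_def H_inv_linear inv_comb_linear)
  qed
  moreover have "cinner4 n (matrix_op n W \<phi>) (matrix_op n W \<psi>) = cinner4 n \<phi> \<psi>"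
    if "\<phi> \<in> H_inv n" "\<psi> \<in> H_inv n" for \<phi> \<psi>
  proof -
    have "cinner4 n (matrix_op n W \<phi>) (matrix_op n W \<psi>)
        = (\<Sum>J\<le>n. cnj (\<Sum>K\<le>n. W J K * coord n K \<phi>) * (\<Sum>L\<le>n. W J L * coord n L \<psi>))"
      using that by (simp add: matrix_op_def cinner4_inv_comb)
    also have "\<dots> = (\<Sum>J\<le>n. \<Sum>K\<le>n. \<Sum>L\<le>n. cnj (coord n K \<phi>) * coord n L \<psi> * (cnj (W J K) * W J L))"
      unfolding cnj_sum sum_product by (simp add: mult_ac)
    also have "\<dots> = (\<Sum>K\<le>n. \<Sum>L\<le>n. cnj (coord n K \<phi>) * coord n L \<psi> * (\<Sum>J\<le>n. cnj (W J K) * W J L))"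
      by (subst sum.swap, rule sum.cong[OF refl], subst sum.swap) (simp add: sum_distrib_left)
    also have "\<dots> = (\<Sum>K\<le>n. \<Sum>L\<le>n. if L = K then cnj (coord n K \<phi>) * coord n K \<psi> else 0)"
      by (intro sum.cong refl) (simp add: VW)
    finally show ?thesis using that by (simp add: cinner4_coord)
  qed
  ultimately show ?thesis
    unfolding unitary_group_def by (simp add: matrix_op_def)
qed

lemma continuous_eval [continuous_intros]: "continuous_on S (\<lambda>V::tensor4 \<Rightarrow> tensor4. V \<phi> i)"
proof -
  have "continuous_on UNIV (\<lambda>\<psi>::tensor4. \<psi> i)" "continuous_on UNIV (\<lambda>V::tensor4 \<Rightarrow> tensor4. V \<phi>)"
    by (rule continuous_on_product_coordinates)+
  then have "continuous_on UNIV (\<lambda>V::tensor4 \<Rightarrow> tensor4. V \<phi> i)"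
    by (rule continuous_on_compose2) auto
  then show ?thesis by (rule continuous_on_subset) simp
qed

lemma continuous_coord: "continuous_on S (\<lambda>V::tensor4 \<Rightarrow> tensor4. coord n J (V \<phi>))"
  unfolding coord_def cinner4_def by (intro continuous_intros)

lemma unitary_group_in_H_inv: "V \<in> unitary_group n \<Longrightarrow> \<psi> \<in> H_inv n \<Longrightarrow> V \<psi> \<in> H_inv n"
  by (auto simp: unitary_group_def bij_betw_def)

lemma unitary_group_compose:
  assumes "U \<in> unitary_group n" "V \<in> unitary_group n"
  shows "compose (H_inv n) U V \<in> unitary_group n"
proof -
  have "bij_betw (compose (H_inv n) U V) (H_inv n) (H_inv n)"
    using assms by (intro bij_betw_compose) (auto simp: unitary_group_def)
  then show ?thesis
    using assms unitary_group_in_H_inv[OF assms(2)]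
    unfolding unitary_group_def by (simp add: compose_def H_inv_linear)
qed

text \<open>Supplies the measurability of left translation for the change of variables in
  \<open>haar_vector_coord\<close>. In the topology of pointwise convergence it is checked at each
  argument: inside \<open>H_inv n\<close> the value depends on finitely many continuous coordinates,
  outside it is constant.\<close>

lemma continuous_compose:
  "continuous_on (unitary_group n) (\<lambda>V. compose (H_inv n) (matrix_op n W) V)"
proof (rule continuous_on_coordinatewise_then_product, rule continuous_on_coordinatewise_then_product)
  fix \<phi> i
  show "continuous_on (unitary_group n) (\<lambda>V. compose (H_inv n) (matrix_op n W) V \<phi> i)"
  proof (cases "\<phi> \<in> H_inv n")
    case True
    obtain a b c d where i: "i = (a, b, c, d)" by (cases i)
    have "continuous_on (unitary_group n) (\<lambda>V. inv_comb n (\<lambda>J. \<Sum>K\<le>n. W J K * coord n K (V \<phi>)) i)"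
      unfolding i inv_comb_def prod.case by (intro continuous_intros continuous_coord)
    then show ?thesis
      by (rule continuous_on_eq)
        (simp add: compose_def True matrix_op_def unitary_group_in_H_inv)
  qed (simp add: compose_def)
qed

text \<open>Left translation by \<open>U\<close> replaces \<open>V v0\<close> by
  \<open>U (V v0)\<close>, so left invariance of the measure becomes unitary invariance of the
  random vector, whatever the starting vector \<open>v0\<close>.\<close>

lemma haar_vector_coord:
  assumes \<mu>: "haar_unitary n \<mu>" and v0: "v0 \<in> H_inv n" "cinner4 n v0 v0 = 1"
  shows "haar_vector \<mu> n (\<lambda>J V. coord n J (V v0))"
proof -
  have sets: "sets \<mu> = sets (restrict_space borel (unitary_group n))"
    and one: "emeasure \<mu> (space \<mu>) = 1"
    and inv: "\<And>U. U \<in> unitary_group n \<Longrightarrow> distr \<mu> \<mu> (\<lambda>V. compose (H_inv n) U V) = \<mu>"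
    using \<mu> by (auto simp: haar_unitary_def)
  have space: "space \<mu> = unitary_group n"
    using sets_eq_imp_space_eq[OF sets] by (simp add: space_restrict_space)
  interpret prob_space \<mu> by standard (rule one)
  show ?thesis
  proof
    fix J
    show "(\<lambda>V. coord n J (V v0)) \<in> borel_measurable \<mu>"
      unfolding measurable_cong_sets[OF sets refl]
      by (rule borel_measurable_continuous_on_restrict[OF continuous_coord])
  next
    fix V assume "V \<in> space \<mu>"
    then have V: "V \<in> unitary_group n" by (simp add: space)
    then have "cinner4 n (V v0) (V v0) = 1" using v0 by (simp add: unitary_group_def)
    then have "complex_of_real (\<Sum>J\<le>n. (cmod (coord n J (V v0)))\<^sup>2) = 1"
      unfolding of_real_sum complex_norm_square
      using cinner4_coord[OF unitary_group_in_H_inv[OF V v0(1)] unitary_group_in_H_inv[OF V v0(1)]]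
      by (simp add: mult.commute)
    then show "(\<Sum>J\<le>n. (cmod (coord n J (V v0)))\<^sup>2) = 1" by (simp only: of_real_eq_1_iff)
  next
    fix W and g :: "(nat \<Rightarrow> complex) \<Rightarrow> complex"
    assume W: "unitary_matrix n W"
      and g: "\<And>u v. (\<And>J. J \<le> n \<Longrightarrow> u J = v J) \<Longrightarrow> g u = g v"
      and meas: "(\<lambda>V. g (\<lambda>J. coord n J (V v0))) \<in> borel_measurable \<mu>"
    let ?T = "\<lambda>V. compose (H_inv n) (matrix_op n W) V"
    have U: "matrix_op n W \<in> unitary_group n" by (rule matrix_op_unitary[OF W])
    have T: "?T \<in> measurable \<mu> \<mu>"
      unfolding measurable_cong_sets[OF sets sets]
      by (rule measurable_restrict_space2)
        (auto simp: space_restrict_space unitary_group_compose[OF U]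
          intro!: borel_measurable_continuous_on_restrict continuous_compose)
    have "(\<integral>V. g (\<lambda>J. coord n J (V v0)) \<partial>\<mu>) = (\<integral>V. g (\<lambda>J. coord n J (V v0)) \<partial>distr \<mu> \<mu> ?T)"
      by (simp only: inv[OF U])
    also have "\<dots> = (\<integral>V. g (\<lambda>J. coord n J (?T V v0)) \<partial>\<mu>)"
      by (rule integral_distr[OF T meas])
    also have "\<dots> = (\<integral>V. g (\<lambda>J. \<Sum>K\<le>n. W J K * coord n K (V v0)) \<partial>\<mu>)"
      by (intro Bochner_Integration.integral_cong refl g)
        (simp add: compose_def v0 coord_matrix_op unitary_group_in_H_inv space)
    finally show "(\<integral>V. g (\<lambda>J. \<Sum>K\<le>n. W J K * coord n K (V v0)) \<partial>\<mu>)
        = (\<integral>V. g (\<lambda>J. coord n J (V v0)) \<partial>\<mu>)" ..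
  qed
qed

section \<open>Elementary estimates and the concentration bound\<close>

lemma Lam_tendsto: "filterlim Lam at_top sequentially"
proof (rule filterlim_at_top_mono)
  show "filterlim (\<lambda>n. 1 / 2 * harm (Suc n) :: real) at_top sequentially"
    by (intro filterlim_tendsto_pos_mult_at_top[OF tendsto_const] filterlim_compose[OF harm_at_top filterlim_Suc]) simp
  have "1 / 2 * harm (Suc n) \<le> Lam n" for n
  proof -
    have "1 / 2 * harm (Suc n) = (\<Sum>I\<le>n. 1 / (2 * (real I + 1)))"
      unfolding harm_def sum_distrib_left
      by (rule sum.reindex_bij_witness[of _ Suc "\<lambda>k. k - 1"]) (auto simp: field_simps)
    also have "\<dots> \<le> (\<Sum>I\<le>n. 1 / (2 * real I + 1))"
      by (intro sum_mono divide_left_mono) auto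
    finally show ?thesis by (simp add: Lam_def atMost_atLeast0)
  qed
  then show "\<forall>\<^sub>F n in sequentially. 1 / 2 * harm (Suc n) \<le> Lam n" by simp
qed

text \<open>The correction term makes the induction telescope: the square of
  \<open>2 * n + 3\<close> exceeds \<open>4 * (n + 1) * (n + 2)\<close> by 1. At
  \<open>n = 0\<close> equality holds, which is the origin of 5/4.\<close>

lemma sum_odd_reciprocal_squares: "(\<Sum>J\<le>n. (1 / (2 * real J + 1))\<^sup>2) \<le> 5 / 4 - 1 / (4 * (real n + 1))"
proof (induction n)
  case (Suc n)
  have "(1 / (2 * real (Suc n) + 1))\<^sup>2 \<le> 1 / (4 * (real n + 1)) - 1 / (4 * (real (Suc n) + 1))"
    by (simp add: power2_eq_square divide_simps) (simp add: algebra_simps)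
  then show ?case using Suc by simp
qed simp

text \<open>Half of the permitted logarithmic error is spent as relative error. The lower side is
  the critical one: \<open>(1 + \<delta>) * (1 - \<delta> / 2)\<close> is at least 1 exactly when
  \<open>\<delta>^2\<close> is at most \<open>\<delta>\<close>, whence the restriction to
  \<open>\<delta> \<le> 1\<close>.\<close>

lemma ln_ratio_close:
  fixes X m \<delta> :: real
  assumes "0 < \<delta>" "\<delta> \<le> 1" "m > 0" "\<bar>X - m\<bar> < \<delta> / 2 * m"
  shows "\<bar>ln m - ln X\<bar> \<le> \<delta>"
proof -
  have up: "X < (1 + \<delta> / 2) * m" and low: "(1 - \<delta> / 2) * m < X"
  proof -
    have "X - m < \<delta> / 2 * m" "m - X < \<delta> / 2 * m" using assms(4) by linarith+
    then show "X < (1 + \<delta> / 2) * m" "(1 - \<delta> / 2) * m < X"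
      by (simp_all add: algebra_simps)
  qed
  have "0 \<le> (1 - \<delta> / 2) * m" using assms by simp
  then have X: "X > 0" using low by linarith
  have "1 + \<delta> / 2 \<le> exp \<delta>" using exp_ge_add_one_self[of \<delta>] assms by linarith
  then have "X \<le> exp \<delta> * m"
    using up mult_right_mono[of "1 + \<delta> / 2" "exp \<delta>" m] assms by linarith
  then have 1: "ln X \<le> \<delta> + ln m"
    using ln_mono[of X "exp \<delta> * m"] X assms by (simp add: ln_mult)
  have "1 \<le> (1 + \<delta>) * (1 - \<delta> / 2)"
  proof -
    have "\<delta> * \<delta> \<le> \<delta>" using assms by (simp add: mult_left_le)
    then show ?thesis by (simp add: algebra_simps)
  qed
  also have "\<dots> \<le> exp \<delta> * (1 - \<delta> / 2)"
    using assms exp_ge_add_one_self[of \<delta>] by (intro mult_right_mono) auto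
  finally have "m \<le> exp \<delta> * (1 - \<delta> / 2) * m" using assms by simp
  also have "\<dots> \<le> exp \<delta> * X" using low by (simp add: mult.assoc)
  finally have 2: "ln m \<le> \<delta> + ln X"
    using ln_mono[of m "exp \<delta> * X"] X assms by (simp add: ln_mult)
  show ?thesis using 1 2 by linarith
qed

lemma S2_concentration:
  assumes "0 < \<delta>" "\<delta> \<le> 1" "haar_unitary n \<mu>" "v0 \<in> H_inv n" "cinner4 n v0 v0 = 1"
  shows "measure \<mu> {U \<in> space \<mu>. \<bar>S2 n (U v0) - S2_bar n\<bar> \<le> \<delta>}
    \<ge> 1 - 3 * pi\<^sup>2 / (\<delta>\<^sup>2 * (Lam n)\<^sup>2)"
proof -
  interpret haar_vector \<mu> n "\<lambda>J V. coord n J (V v0)"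
    by (rule haar_vector_coord[OF assms(3-5)])
  define w where "w = (\<lambda>J. 1 / (2 * real J + 1))"
  define X where "X = (\<lambda>V. \<Sum>J\<le>n. w J * (wt J V)\<^sup>2)"
  define m where "m = mom 2 * Lam n"
  have w: "w J > 0" for J by (simp add: w_def add_nonneg_pos)
  have L: "(\<Sum>J\<le>n. w J) = Lam n" by (simp add: w_def Lam_def atMost_atLeast0)
  have Lpos: "Lam n > 0" unfolding L[symmetric] using w by (intro sum_pos) auto
  have m: "m > 0" using Lpos by (simp add: m_def mom_2)
  \<comment> \<open>Because \<open>(n + 1)^2 + (n + 1)\<close> factors as
    \<open>(n + 1) * (n + 2)\<close>, the reference value is exactly minus the logarithm of the mean
    purity.\<close>
  have bar: "S2_bar n = - ln m"
  proof -
    have "m = (2 * Lam n) / ((real n + 1)\<^sup>2 + (real n + 1))"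
      by (simp add: m_def mom_2 power2_eq_square algebra_simps)
    moreover have "(real n + 1)\<^sup>2 + (real n + 1) > 0" by (simp add: add_nonneg_pos)
    ultimately show ?thesis using Lpos by (simp add: S2_bar_def ln_div)
  qed
  have S2: "S2 n (V v0) = - ln (X V)" if "V \<in> space \<mu>" for V
  proof -
    have V: "V v0 \<in> H_inv n"
    proof -
      have "space \<mu> = unitary_group n"
        using assms(3) sets_eq_imp_space_eq[of \<mu> "restrict_space borel (unitary_group n)"]
        by (simp add: haar_unitary_def space_restrict_space)
      then show ?thesis using that assms(4) unitary_group_in_H_inv by blast
    qed
    show ?thesis
      using S2_inv_comb[OF unit[OF that]] by (simp add: inv_comb_coord[OF V] X_def w_def wt_def)
  qed
  have [measurable]: "X \<in> borel_measurable \<mu>" unfolding X_def by measurable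
  let ?far = "{V \<in> space \<mu>. \<delta> / 2 * m \<le> \<bar>X V - m\<bar>}"
  let ?near = "{V \<in> space \<mu>. \<bar>S2 n (V v0) - S2_bar n\<bar> \<le> \<delta>}"
  \<comment> \<open>Rewriting the event in terms of \<open>X\<close> also provides its
    measurability, which is inherited from the coordinates.\<close>
  have near: "?near = {V \<in> space \<mu>. \<bar>ln m - ln (X V)\<bar> \<le> \<delta>}"
    using S2 by (auto simp: bar)
  have "space \<mu> - ?far \<subseteq> ?near"
    unfolding near using ln_ratio_close[OF assms(1,2) m] by auto
  then have "prob (space \<mu> - ?far) \<le> prob ?near"
    unfolding near by (intro finite_measure_mono) measurable
  moreover have "prob (space \<mu> - ?far) = 1 - prob ?far"
    by (rule prob_compl) measurable
  moreover have "prob ?far \<le> 3 * pi\<^sup>2 / (\<delta>\<^sup>2 * (Lam n)\<^sup>2)"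
  proof -
    have "prob ?far \<le> 5 * (\<Sum>J\<le>n. (w J)\<^sup>2) / ((\<delta> / 2)\<^sup>2 * (Lam n)\<^sup>2)"
      using purity_concentration[of w "\<delta> / 2"] w assms(1)
      unfolding L X_def m_def[symmetric] by simp
    also have "\<dots> = 20 * (\<Sum>J\<le>n. (w J)\<^sup>2) / (\<delta>\<^sup>2 * (Lam n)\<^sup>2)"
      by (simp add: power_divide)
    also have "\<dots> \<le> 3 * pi\<^sup>2 / (\<delta>\<^sup>2 * (Lam n)\<^sup>2)"
    proof (rule divide_right_mono)
      have "(\<Sum>J\<le>n. (w J)\<^sup>2) \<le> 5 / 4"
        unfolding w_def by (rule order_trans[OF sum_odd_reciprocal_squares]) simp
      moreover have "3\<^sup>2 \<le> pi\<^sup>2" using pi_gt3 by (intro power_mono) auto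
      ultimately show "20 * (\<Sum>J\<le>n. (w J)\<^sup>2) \<le> 3 * pi\<^sup>2" by simp
    qed simp
    finally show ?thesis .
  qed
  ultimately show ?thesis by linarith
qed

theorem mainTheorem4:
  "\<exists>\<delta>0::real. \<delta>0 > 0 \<and> (\<forall>\<delta>. 0 < \<delta> \<and> \<delta> \<le> \<delta>0 \<longrightarrow>
     (\<forall>\<^sub>F n in sequentially. \<forall>\<mu> v0.
        haar_unitary n \<mu> \<longrightarrow> v0 \<in> H_inv n \<longrightarrow> cinner4 n v0 v0 = 1 \<longrightarrow>
        measure \<mu> {U \<in> space \<mu>. \<bar>S2 n (U v0) - S2_bar n\<bar> \<le> \<delta>}
          \<ge> 1 - 3 * pi\<^sup>2 / (\<delta>\<^sup>2 * (Lam n)\<^sup>2)) \<and>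
     ((\<lambda>n. 1 - 3 * pi\<^sup>2 / (\<delta>\<^sup>2 * (Lam n)\<^sup>2)) \<longlonglongrightarrow> 1))"
proof (intro exI[of _ 1] conjI allI impI)
  fix \<delta> :: real assume \<delta>: "0 < \<delta> \<and> \<delta> \<le> 1"
  show "\<forall>\<^sub>F n in sequentially. \<forall>\<mu> v0.
        haar_unitary n \<mu> \<longrightarrow> v0 \<in> H_inv n \<longrightarrow> cinner4 n v0 v0 = 1 \<longrightarrow>
        measure \<mu> {U \<in> space \<mu>. \<bar>S2 n (U v0) - S2_bar n\<bar> \<le> \<delta>}
          \<ge> 1 - 3 * pi\<^sup>2 / (\<delta>\<^sup>2 * (Lam n)\<^sup>2)"
    using S2_concentration \<delta> by (intro always_eventually) blast
  have "filterlim (\<lambda>n. \<delta>\<^sup>2 * (Lam n)\<^sup>2) at_top sequentially"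
    using \<delta> by (intro filterlim_tendsto_pos_mult_at_top[OF tendsto_const] filterlim_pow_at_top Lam_tendsto) auto
  then have "(\<lambda>n. 3 * pi\<^sup>2 / (\<delta>\<^sup>2 * (Lam n)\<^sup>2)) \<longlonglongrightarrow> 0"
    by (intro tendsto_divide_0[OF tendsto_const] filterlim_at_top_imp_at_infinity)
  from tendsto_diff[OF tendsto_const this, of 1]
  show "(\<lambda>n. 1 - 3 * pi\<^sup>2 / (\<delta>\<^sup>2 * (Lam n)\<^sup>2)) \<longlonglongrightarrow> 1" by simp
qed simp

end
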